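(* The family $\tilde{\mathfrak{n}}_t = (\mathbb{R}^9,\tilde\mu_t)$, $t\in(1,\infty)$, is a curve of pairwise non-isomorphic nilpotent Lie algebras, none of which is an Einstein nilradical. That is: for $t,s\in(1,\infty)$ with $t\neq s$ the real Lie algebras $\tilde{\mathfrak{n}}_t$ and $\tilde{\mathfrak{n}}_s$ are not isomorphic, and for every $t\in(1,\infty)$ the Lie algebra $\tilde{\mathfrak{n}}_t$ is not an Einstein nilradical.
   Context: Let $e_1,\dots,e_9$ be the canonical basis of $\mathbb{R}^9$. For $t\in\mathbb{R}$, $\tilde{\mathfrak{n}}_t=(\mathbb{R}^9,\tilde\mu_t)$ is the real $2$-step nilpotent Lie algebra whose bracket $\tilde\mu_t$ is the skew-symmetric bilinear map determined by $$\tilde\mu_t(e_5,e_4)=e_7,\quad \tilde\mu_t(e_1,e_6)=e_8,\quad \tilde\mu_t(e_3,e_2)=e_9,$$ $$\tilde\mu_t(e_3,e_6)=t\,e_7,\quad \tilde\mu_t(e_5,e_2)=t\,e_8,\quad \tilde\mu_t(e_1,e_4)=t\,e_9,\quad \tilde\mu_t(e_1,e_2)=e_7,$$ all other brackets of basis vectors not obtained from these by skew-symmetry being zero. Einstein nilradical: a real nilpotent Lie algebra $\mathfrak{n}$ is called an Einstein nilradical if it is the nilradical (maximal nilpotent ideal) of the Lie algebra of a (standard) Einstein solvmanifold. Equivalently, $\mathfrak{n}$ admits an inner product $\langle\cdot,\cdot\rangle$ such that $\mathrm{Ric}_{\langle\cdot,\cdot\rangle}=cI+D$ for some $c\in\mathbb{R}$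 and some derivation $D\in\mathrm{Der}(\mathfrak{n})$. Here $\mathrm{Ric}_{\langle\cdot,\cdot\rangle}$ is the Ricci operator of the corresponding left invariant metric on the simply connected Lie group with Lie algebra $\mathfrak{n}$; for a nilpotent Lie algebra with bracket $\mu$ and any orthonormal basis $\{x_i\}$ of $(\mathfrak{n},\langle\cdot,\cdot\rangle)$ it is given by $$\langle \mathrm{Ric}\,X,Y\rangle=-\tfrac12\sum_{i,j}\langle\mu(X,x_i),x_j\rangle\langle\mu(Y,x_i),x_j\rangle+\tfrac14\sum_{i,j}\langle\mu(x_i,x_j),X\rangle\langle\mu(x_i,x_j),Y\rangle .$$ *)

theory Defs
  imports "HOL-Analysis.Analysis"
begin

section \<open>Real Lie algebras\<close>

text \<open>A real Lie algebra is a real vector space type together with a bracket. Subalgebras and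
  ideals are subsets of the type.\<close>

definition is_lie_bracket :: "('a::real_vector \<Rightarrow> 'a \<Rightarrow> 'a) \<Rightarrow> bool" where
  "is_lie_bracket br \<longleftrightarrow> bilinear br \<and> (\<forall>x. br x x = 0) \<and>
     (\<forall>x y z. br x (br y z) + br y (br z x) + br z (br x y) = 0)"

definition lie_isomorphic ::
    "('a::real_vector \<Rightarrow> 'a \<Rightarrow> 'a) \<Rightarrow> ('b::real_vector \<Rightarrow> 'b \<Rightarrow> 'b) \<Rightarrow> bool" where
  "lie_isomorphic br br' \<longleftrightarrow>
     (\<exists>f. linear f \<and> bij f \<and> (\<forall>x y. f (br x y) = br' (f x) (f y)))"

definition lie_product :: "('a::real_vector \<Rightarrow> 'a \<Rightarrow> 'a) \<Rightarrow> 'a set \<Rightarrow> 'a set \<Rightarrow> 'a set" where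
  "lie_product br A B = span {br x y | x y. x \<in> A \<and> y \<in> B}"

fun lower_central_series ::
    "('a::real_vector \<Rightarrow> 'a \<Rightarrow> 'a) \<Rightarrow> 'a set \<Rightarrow> nat \<Rightarrow> 'a set" where
  "lower_central_series br N 0 = N"
| "lower_central_series br N (Suc k) = lie_product br N (lower_central_series br N k)"

fun derived_series :: "('a::real_vector \<Rightarrow> 'a \<Rightarrow> 'a) \<Rightarrow> 'a set \<Rightarrow> nat \<Rightarrow> 'a set" where
  "derived_series br S 0 = S"
| "derived_series br S (Suc k) =
     lie_product br (derived_series br S k) (derived_series br S k)"

definition lie_nilpotent :: "('a::real_vector \<Rightarrow> 'a \<Rightarrow> 'a) \<Rightarrow> 'a set \<Rightarrow> bool" where
  "lie_nilpotent br N \<longleftrightarrow> (\<exists>k. lower_central_series br N k = {0})"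

definition lie_solvable :: "('a::real_vector \<Rightarrow> 'a \<Rightarrow> 'a) \<Rightarrow> 'a set \<Rightarrow> bool" where
  "lie_solvable br S \<longleftrightarrow> (\<exists>k. derived_series br S k = {0})"

definition lie_ideal :: "('a::real_vector \<Rightarrow> 'a \<Rightarrow> 'a) \<Rightarrow> 'a set \<Rightarrow> bool" where
  "lie_ideal br N \<longleftrightarrow> subspace N \<and> (\<forall>x. \<forall>y\<in>N. br x y \<in> N)"

definition is_nilradical :: "('a::real_vector \<Rightarrow> 'a \<Rightarrow> 'a) \<Rightarrow> 'a set \<Rightarrow> bool" where
  "is_nilradical br N \<longleftrightarrow> lie_ideal br N \<and> lie_nilpotent br N \<and>
     (\<forall>I. lie_ideal br I \<and> lie_nilpotent br I \<longrightarrow> I \<subseteq> N)"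


section \<open>Curvature of left invariant metrics\<close>

text \<open>A bracket on a Euclidean space determines a simply connected Lie group with a left invariant
  metric, whose inner product at the identity is that of the Euclidean space. The Levi-Civita
  connection on left invariant fields is given by the Koszul formula
  \<open>2 \<langle>\<nabla>\<^sub>x y, z\<rangle> = \<langle>[x,y], z\<rangle> - \<langle>[y,z], x\<rangle> + \<langle>[z,x], y\<rangle>\<close>,
  the curvature by \<open>R(x,y) = [\<nabla>\<^sub>x, \<nabla>\<^sub>y] - \<nabla>\<^bsub>[x,y]\<^esub>\<close>, and the Ricci form \<open>ric(y,z)\<close> is
  the trace of \<open>x \<mapsto> R(x,y)z\<close>.\<close>

definition levi_civita ::
    "('a::euclidean_space \<Rightarrow> 'a \<Rightarrow> 'a) \<Rightarrow> 'a \<Rightarrow> 'a \<Rightarrow> 'a" where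
  "levi_civita br x y =
     (\<Sum>b\<in>Basis. ((br x y \<bullet> b - br y b \<bullet> x + br b x \<bullet> y) / 2) *\<^sub>R b)"

definition riemann_curvature ::
    "('a::euclidean_space \<Rightarrow> 'a \<Rightarrow> 'a) \<Rightarrow> 'a \<Rightarrow> 'a \<Rightarrow> 'a \<Rightarrow> 'a" where
  "riemann_curvature br x y z =
     levi_civita br x (levi_civita br y z) - levi_civita br y (levi_civita br x z)
       - levi_civita br (br x y) z"

definition ricci_form ::
    "('a::euclidean_space \<Rightarrow> 'a \<Rightarrow> 'a) \<Rightarrow> 'a \<Rightarrow> 'a \<Rightarrow> real" where
  "ricci_form br y z = (\<Sum>b\<in>Basis. riemann_curvature br b y z \<bullet> b)"

definition einstein_metric :: "('a::euclidean_space \<Rightarrow> 'a \<Rightarrow> 'a) \<Rightarrow> bool" where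
  "einstein_metric br \<longleftrightarrow> (\<exists>c. \<forall>x y. ricci_form br x y = c * (x \<bullet> y))"

text \<open>Standard means that the orthogonal complement of the derived algebra is abelian.\<close>

definition standard_einstein_solvmanifold ::
    "('a::euclidean_space \<Rightarrow> 'a \<Rightarrow> 'a) \<Rightarrow> bool" where
  "standard_einstein_solvmanifold br \<longleftrightarrow>
     is_lie_bracket br \<and> lie_solvable br UNIV \<and> einstein_metric br \<and>
     (\<forall>x \<in> orthogonal_comp (lie_product br UNIV UNIV).
      \<forall>y \<in> orthogonal_comp (lie_product br UNIV UNIV). br x y = 0)"

text \<open>Since a definition cannot quantify over types, the Euclidean space \<open>'s\<close> underlying the
  solvable Lie algebra is a parameter. Every nonzero finite-dimensional inner product space
  is isometric to one of these, so a Lie algebra is an Einstein nilradical iff the following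
  holds for some \<open>'s\<close>, and fails to be one iff the following is false for all \<open>'s\<close>.\<close>

definition einstein_nilradical ::
    "'s::euclidean_space itself \<Rightarrow> ('n::real_vector \<Rightarrow> 'n \<Rightarrow> 'n) \<Rightarrow> bool" where
  "einstein_nilradical (_ :: 's itself) br \<longleftrightarrow>
     (\<exists>(sbr :: 's \<Rightarrow> 's \<Rightarrow> 's) \<phi>. standard_einstein_solvmanifold sbr \<and>
        linear \<phi> \<and> inj \<phi> \<and> (\<forall>x y. \<phi> (br x y) = sbr (\<phi> x) (\<phi> y)) \<and>
        is_nilradical sbr (range \<phi>))"


section \<open>The family of brackets\<close>

text \<open>The indices are read in the type \<open>9\<close>, where \<open>9 = 0\<close>; the numerals from 1 to 9 are
  pairwise distinct.\<close>

abbreviation bv :: "9 \<Rightarrow> real ^ 9" where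
  "bv i \<equiv> axis i 1"

definition minor2 :: "real ^ 9 \<Rightarrow> real ^ 9 \<Rightarrow> 9 \<Rightarrow> 9 \<Rightarrow> real" where
  "minor2 x y i j = x $ i * y $ j - x $ j * y $ i"

definition mu :: "real \<Rightarrow> real ^ 9 \<Rightarrow> real ^ 9 \<Rightarrow> real ^ 9" where
  "mu t x y =
     minor2 x y 5 4 *\<^sub>R bv 7 + minor2 x y 1 6 *\<^sub>R bv 8 + minor2 x y 3 2 *\<^sub>R bv 9
     + (t * minor2 x y 3 6) *\<^sub>R bv 7 + (t * minor2 x y 5 2) *\<^sub>R bv 8
     + (t * minor2 x y 1 4) *\<^sub>R bv 9 + minor2 x y 1 2 *\<^sub>R bv 7"

lemma bilinear_mu: "bilinear (mu t)"
  unfolding bilinear_def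
  by (auto intro!: linearI simp: mu_def minor2_def vec_eq_iff algebra_simps)

lemma mu_skew: "mu t y x = - mu t x y"
  by (simp add: mu_def minor2_def vec_eq_iff algebra_simps)

lemma mu_basis:
  "mu t (bv 5) (bv 4) = bv 7" "mu t (bv 1) (bv 6) = bv 8" "mu t (bv 3) (bv 2) = bv 9"
  "mu t (bv 3) (bv 6) = t *\<^sub>R bv 7" "mu t (bv 5) (bv 2) = t *\<^sub>R bv 8" "mu t (bv 1) (bv 4) = t *\<^sub>R bv 9"
  "mu t (bv 1) (bv 2) = bv 7"
  by (simp_all add: mu_def minor2_def axis_def)

lemma minor2_basis_zero: "{i, j} \<noteq> {a, b} \<Longrightarrow> minor2 (bv i) (bv j) a b = 0"
  by (auto simp: minor2_def axis_def doubleton_eq_iff)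

lemma mu_basis_zero:
  assumes "{i, j} \<notin> {{5, 4}, {1, 6}, {3, 2}, {3, 6}, {5, 2}, {1, 4}, {1, 2}}"
  shows "mu t (bv i) (bv j) = 0"
proof -
  have "minor2 (bv i) (bv j) a b = 0"
    if "{a, b} \<in> {{5, 4}, {1, 6}, {3, 2}, {3, 6}, {5, 2}, {1, 4}, {1, 2}}" for a b
    using assms that minor2_basis_zero[of i j a b] by metis
  then show ?thesis
    by (simp add: mu_def)
qed

lemma mu_two_step: "mu t x (mu t y z) = 0"
  by (simp add: mu_def minor2_def axis_def)

lemma is_lie_bracket_mu: "is_lie_bracket (mu t)"
  unfolding is_lie_bracket_def
  by (simp add: bilinear_mu mu_two_step) (simp add: mu_def minor2_def)

lemma lie_nilpotent_mu: "lie_nilpotent (mu t) UNIV"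
proof -
  have "mu t x y = 0" if "y \<in> lie_product (mu t) UNIV UNIV" for x y
    using that unfolding lie_product_def
  proof (induction rule: span_induct_alt)
    case base
    show ?case by (simp add: bilinear_rzero[OF bilinear_mu])
  next
    case (step c z w)
    then show ?case
      by (auto simp: bilinear_radd[OF bilinear_mu] bilinear_rmul[OF bilinear_mu] mu_two_step)
  qed
  then have "{mu t x y |x y. x \<in> UNIV \<and> y \<in> lie_product (mu t) UNIV UNIV} = {0}"
    by (auto intro!: exI[of _ 0] simp: lie_product_def span_zero)
  then have "lower_central_series (mu t) UNIV (Suc (Suc 0)) = {0}"
    by (simp only: lower_central_series.simps) (simp only: lie_product_def, simp)
  then show ?thesis
    unfolding lie_nilpotent_def by blast
qed

end

theory Submission
  imports Defs
begin

text \<open>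
  \<^bold>\<open>Why the algebras are pairwise non-isomorphic.\<close> Composing the bracket \<open>mu t\<close> with the functional
  \<open>a e\<^sub>7\<^sup>* + b e\<^sub>8\<^sup>* + c e\<^sub>9\<^sup>*\<close> gives a 2-form on \<open>\<langle>e\<^sub>1, \<dots>, e\<^sub>6\<rangle>\<close> whose Pfaffian is, up to sign, the cubic
  \<open>a (t a\<^sup>2 - (1 + t\<^sup>3) b c)\<close>: a conic together with the line \<open>a = 0\<close>. An isomorphism must carry
  this line to itself, because the conic contains no line, and hence it preserves the centre line
  \<open>\<langle>e\<^sub>7\<rangle>\<close> on which all these functionals vanish. Along the line the radicals of the forms lie in
  \<open>W = \<langle>e\<^sub>3, e\<^sub>4, e\<^sub>5, e\<^sub>6\<rangle>\<close> modulo the centre. The two radicals that commute with themselves,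
  \<open>\<langle>e\<^sub>3, e\<^sub>4\<rangle>\<close> and \<open>\<langle>e\<^sub>5, e\<^sub>6\<rangle>\<close>, are distinguished up to order; the other radicals identify one with
  the other up to scale, and the \<open>e\<^sub>7\<close>-component of the bracket pairs them. The resulting bilinear
  form on a plane has matrix \<open>(0, t\<^sup>3; -1, 0)\<close> up to scale, and its asymmetry determines
  \<open>{t\<^sup>3, t\<^sup>-\<^sup>3}\<close>. For \<open>t > 1\<close> this determines \<open>t\<close>. The lemmas that carry this are
  \<open>degenerate_form_conic\<close>, \<open>line_in_degenerate_cubic\<close> and \<open>congruent_forms_rigid\<close>.

  \<^bold>\<open>Why none of them is an Einstein nilradical.\<close> Put \<open>P = \<langle>e\<^sub>3, \<dots>, e\<^sub>9\<rangle>\<close> and \<open>L = [P, P] = \<langle>e\<^sub>7\<rangle>\<close>. All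
  derivations preserve \<open>L\<close> and \<open>P\<close>, and \<open>s \<supseteq> P \<supseteq> L\<close> is a filtration of any solvable \<open>s\<close> with this
  nilradical: \<open>[s, P] \<subseteq> P\<close>, \<open>[s, L] \<subseteq> L\<close>, \<open>[P, P] \<subseteq> L\<close>, \<open>[P, L] = 0\<close>. Let \<open>F\<close> be the sum of the
  orthogonal projections onto \<open>P\<close> and \<open>L\<close>, so that \<open>F\<close> has the eigenvalues 0, 1, 2 of the
  filtration. Pairing the Ricci operator of an Einstein metric \<open>ric = e \<langle>\<cdot>,\<cdot>\<rangle>\<close> with \<open>F\<close> gives
  \<open>8 e = Q / 4 - tr (ad H \<circ> F)\<close>, where \<open>H\<close> is the mean curvature vector and \<open>Q \<ge> 0\<close> measures how far
  the filtration is from being an orthogonal grading. The weights of a derivation satisfy relations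
  which turn \<open>tr (ad H \<circ> F)\<close> into \<open>tr (ad H) = |H|\<^sup>2\<close>. On the other hand \<open>ric(H, H)\<close> is minus the squared
  norm of the symmetric part of \<open>ad H\<close>, and by the Cauchy-Schwarz inequality against the derivation with weights
  1 on \<open>e\<^sub>1, \<dots>, e\<^sub>6\<close> and 2 on the centre this yields \<open>e |H|\<^sup>2 \<le> - |H|\<^sup>4 / 8\<close>. Hence \<open>8 e + |H|\<^sup>2 \<le> 0\<close>,
  so \<open>Q = 0\<close> and the filtration is a grading. This is impossible: a grading would provide a complement of \<open>P\<close>
  that removes the bracket \<open>[e\<^sub>1, e\<^sub>2] = e\<^sub>7\<close>. The steps are \<open>grade_superadditive\<close> for \<open>Q \<ge> 0\<close>,
  \<open>sum_grade_ricci\<close>, \<open>weights_square_sum\<close>, \<open>einstein_defect_zero\<close> and \<open>no_graded_complement\<close>. In other words, the degeneration that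
  contracts this bracket to zero is what obstructs an Einstein metric.
\<close>

section \<open>The Ricci form in an orthonormal basis\<close>

text \<open>A basis given as a set can be adapted to a flag of subspaces, which the fixed coordinate basis
  in the definition of the Ricci form cannot.\<close>

definition orthonormal_basis :: "'a::euclidean_space set \<Rightarrow> bool" where
  "orthonormal_basis B \<longleftrightarrow> pairwise orthogonal B \<and> (\<forall>b\<in>B. norm b = 1) \<and> span B = UNIV"

lemma orthonormal_basis_finite: "orthonormal_basis B \<Longrightarrow> finite B"
  unfolding orthonormal_basis_def
  by (metis pairwise_orthogonal_imp_finite)

lemma orthonormal_basis_inner:
  assumes "orthonormal_basis B" "b \<in> B" "c \<in> B"
  shows "b \<bullet> c = (if b = c then 1 else 0)"
  using assms unfolding orthonormal_basis_def pairwise_def orthogonal_def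
  by (auto simp: norm_eq_1)

lemma orthonormal_basis_expand:
  fixes v :: "'a::euclidean_space"
  assumes B: "orthonormal_basis B"
  shows "v = (\<Sum>b\<in>B. (v \<bullet> b) *\<^sub>R b)"
proof -
  let ?w = "v - (\<Sum>b\<in>B. (v \<bullet> b) *\<^sub>R b)"
  have "?w \<bullet> c = 0" if c: "c \<in> B" for c
  proof -
    have "(\<Sum>b\<in>B. (v \<bullet> b) * (b \<bullet> c)) = (\<Sum>b\<in>B. if b = c then v \<bullet> c else 0)"
      using orthonormal_basis_inner[OF B _ c] by (intro sum.cong) auto
    then show ?thesis
      using orthonormal_basis_finite[OF B] c by (simp add: inner_diff_left inner_sum_left)
  qed
  then have "orthogonal ?w y" if "y \<in> span B" for y
    using orthogonal_to_span[OF that, of ?w] by (simp add: orthogonal_def)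
  then have "?w = 0"
    using B unfolding orthonormal_basis_def by (metis UNIV_I orthogonal_self)
  then show ?thesis by simp
qed

lemma orthonormal_basis_parseval:
  fixes v w :: "'a::euclidean_space"
  assumes B: "orthonormal_basis B"
  shows "v \<bullet> w = (\<Sum>b\<in>B. (v \<bullet> b) * (w \<bullet> b))"
proof -
  have "v \<bullet> w = (\<Sum>b\<in>B. (v \<bullet> b) *\<^sub>R b) \<bullet> w"
    using orthonormal_basis_expand[OF B, of v] by simp
  also have "\<dots> = (\<Sum>b\<in>B. (v \<bullet> b) * (w \<bullet> b))"
    by (simp add: inner_sum_left inner_commute[of w])
  finally show ?thesis .
qed

text \<open>Traces are all that the Ricci form takes from the coordinate basis, so this is what moves the
  curvature computation to an adapted basis.\<close>

lemma trace_orthonormal_basis: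
  fixes g :: "'a::euclidean_space \<Rightarrow> 'a"
  assumes B: "orthonormal_basis B" and g: "linear g"
  shows "(\<Sum>b\<in>Basis. g b \<bullet> b) = (\<Sum>b\<in>B. g b \<bullet> b)"
proof -
  have "(\<Sum>b\<in>Basis. g b \<bullet> b) = (\<Sum>b\<in>Basis. \<Sum>c\<in>B. (g b \<bullet> c) * (b \<bullet> c))"
    by (subst orthonormal_basis_parseval[OF B]) simp
  also have "\<dots> = (\<Sum>c\<in>B. \<Sum>b\<in>Basis. (g b \<bullet> c) * (b \<bullet> c))"
    by (rule sum.swap)
  also have "\<dots> = (\<Sum>c\<in>B. g c \<bullet> c)"
  proof (rule sum.cong)
    fix c assume "c \<in> B"
    have "g c = g (\<Sum>b\<in>Basis. (c \<bullet> b) *\<^sub>R b)"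
      by (simp add: euclidean_representation)
    also have "\<dots> = (\<Sum>b\<in>Basis. (c \<bullet> b) *\<^sub>R g b)"
      by (simp add: linear_sum[OF g] linear_cmul[OF g])
    finally have "g c \<bullet> c = (\<Sum>b\<in>Basis. (c \<bullet> b) *\<^sub>R g b) \<bullet> c" by simp
    then show "(\<Sum>b\<in>Basis. (g b \<bullet> c) * (b \<bullet> c)) = g c \<bullet> c"
      by (simp add: inner_sum_left inner_commute[of c] mult.commute)
  qed simp
  finally show ?thesis .
qed

lemma levi_civita_inner:
  assumes "bilinear br"
  shows "levi_civita br x y \<bullet> z = (br x y \<bullet> z - br y z \<bullet> x + br z x \<bullet> y) / 2"
proof -
  have lin: "linear (br y)" "linear (\<lambda>z. br z x)"
    using assms by (auto simp: bilinear_def)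
  have 1: "br y z = (\<Sum>b\<in>Basis. (z \<bullet> b) *\<^sub>R br y b)"
    by (subst euclidean_representation[of z, symmetric])
       (simp only: linear_sum[OF lin(1)] linear_cmul[OF lin(1)])
  have 2: "br z x = (\<Sum>b\<in>Basis. (z \<bullet> b) *\<^sub>R br b x)"
    by (subst euclidean_representation[of z, symmetric])
       (simp only: linear_sum[OF lin(2)] linear_cmul[OF lin(2)])
  have "(br x y \<bullet> z - br y z \<bullet> x + br z x \<bullet> y) / 2 =
    ((\<Sum>b\<in>Basis. (br x y \<bullet> b) * (z \<bullet> b)) - (\<Sum>b\<in>Basis. (z \<bullet> b) *\<^sub>R br y b) \<bullet> x
      + (\<Sum>b\<in>Basis. (z \<bullet> b) *\<^sub>R br b x) \<bullet> y) / 2"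
    using 1 2 euclidean_inner[of "br x y" z] by simp
  also have "\<dots> = levi_civita br x y \<bullet> z"
    unfolding levi_civita_def
    by (simp add: inner_sum_left sum.distrib sum_subtractf sum_divide_distrib algebra_simps
        add_divide_distrib diff_divide_distrib inner_commute[of z])
  finally show ?thesis by simp
qed

text \<open>The mean curvature vector \<open>H\<close>, which represents the functional \<open>x \<mapsto> tr (ad x)\<close>.\<close>

definition mean_curvature :: "('a::euclidean_space \<Rightarrow> 'a \<Rightarrow> 'a) \<Rightarrow> 'a" where
  "mean_curvature br = (\<Sum>b\<in>Basis. (\<Sum>c\<in>Basis. br b c \<bullet> c) *\<^sub>R b)"

lemma mean_curvature_inner:
  assumes bil: "bilinear br" and B: "orthonormal_basis B"
  shows "mean_curvature br \<bullet> x = (\<Sum>b\<in>B. br x b \<bullet> b)"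
proof -
  have lin: "linear (\<lambda>x. br x c)" for c using bil by (auto simp: bilinear_def)
  have "br x c = (\<Sum>b\<in>Basis. (x \<bullet> b) *\<^sub>R br b c)" for c
    by (subst euclidean_representation[of x, symmetric])
       (simp only: linear_sum[OF lin] linear_cmul[OF lin])
  then have "(\<Sum>c\<in>Basis. br x c \<bullet> c) = (\<Sum>c\<in>Basis. \<Sum>b\<in>Basis. (x \<bullet> b) * (br b c \<bullet> c))"
    by (simp add: inner_sum_left)
  also have "\<dots> = (\<Sum>b\<in>Basis. \<Sum>c\<in>Basis. (x \<bullet> b) * (br b c \<bullet> c))"
    by (rule sum.swap)
  also have "\<dots> = mean_curvature br \<bullet> x"
    unfolding mean_curvature_def inner_commute[of _ x]
    by (simp add: inner_sum_right sum_distrib_left mult.commute)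
  finally show ?thesis
    using trace_orthonormal_basis[OF B, of "br x"] bil by (simp add: bilinear_def)
qed

lemma linear_levi_civita_right: "bilinear br \<Longrightarrow> linear (levi_civita br x)"
  by (rule linearI)
     (simp_all add: euclidean_eq_iff[where 'a='a] levi_civita_inner inner_add_left inner_add_right
        bilinear_ladd bilinear_radd bilinear_lmul bilinear_rmul field_simps)

lemma linear_levi_civita_left: "bilinear br \<Longrightarrow> linear (\<lambda>x. levi_civita br x y)"
  by (rule linearI)
     (simp_all add: euclidean_eq_iff[where 'a='a] levi_civita_inner inner_add_left inner_add_right
        bilinear_ladd bilinear_radd bilinear_lmul bilinear_rmul field_simps)

text \<open>Write \<open>p\<close> for the matrix of \<open>ad x\<close> and \<open>q\<close> for the skew matrix \<open>\<langle>[b, c], x\<rangle>\<close>. By the Koszul formula the matrices of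
  \<open>b \<mapsto> \<nabla>\<^sub>b x\<close> and \<open>b \<mapsto> \<nabla>\<^sub>x b\<close> are linear in \<open>p\<close>, its transpose and \<open>q\<close>, and metric
  compatibility turns the first two terms of the curvature into \<open>- \<langle>[H, x], x\<rangle>\<close> and a sum of products of
  these matrices. The mixed terms in \<open>p\<close> and \<open>q\<close> cancel because \<open>q\<close> is skew.\<close>

lemma ricci_form_diagonal:
  fixes br :: "'a::euclidean_space \<Rightarrow> 'a \<Rightarrow> 'a"
  assumes bil: "bilinear br" and alt: "\<And>x. br x x = 0" and B: "orthonormal_basis B"
  shows "ricci_form br x x =
    (\<Sum>b\<in>B. \<Sum>c\<in>B. (br b c \<bullet> x)\<^sup>2) / 4 - (\<Sum>b\<in>B. \<Sum>c\<in>B. (br x b \<bullet> c)\<^sup>2) / 2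
    - (\<Sum>b\<in>B. \<Sum>c\<in>B. (br x b \<bullet> c) * (br x c \<bullet> b)) / 2
    - br (mean_curvature br) x \<bullet> x"
proof -
  let ?D = "levi_civita br"
  have skew: "br a b = - br b a" for a b
  proof -
    have "br (a + b) (a + b) = br a a + br a b + (br b a + br b b)"
      by (simp add: bilinear_ladd[OF bil] bilinear_radd[OF bil])
    then have "br a b + br b a = 0"
      by (simp add: alt)
    then show ?thesis by (simp add: eq_neg_iff_add_eq_0)
  qed
  note lc = levi_civita_inner[OF bil]
  have lin: "linear (\<lambda>b. riemann_curvature br b x x)"
  proof -
    have l1: "linear (br x)" "linear (\<lambda>b. br b x)" using bil by (auto simp: bilinear_def)
    show ?thesis
      unfolding riemann_curvature_def
      by (intro linear_compose_sub linear_levi_civita_left[OF bil]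
          linear_compose[OF linear_levi_civita_left[OF bil] linear_levi_civita_right[OF bil], unfolded o_def]
          linear_compose[OF l1(2) linear_levi_civita_left[OF bil], unfolded o_def])
  qed
  have first: "(\<Sum>b\<in>B. ?D b (?D x x) \<bullet> b) = - (br (mean_curvature br) x \<bullet> x)"
  proof -
    have "(\<Sum>b\<in>B. ?D b (?D x x) \<bullet> b) = (\<Sum>b\<in>B. - (br (?D x x) b \<bullet> b))"
      by (intro sum.cong refl) (simp add: lc alt skew[of _ "?D x x"])
    also have "\<dots> = - (?D x x \<bullet> mean_curvature br)"
      by (simp add: sum_negf mean_curvature_inner[OF bil B] inner_commute)
    also have "?D x x \<bullet> mean_curvature br = br (mean_curvature br) x \<bullet> x"
      using skew[of x "mean_curvature br"] by (simp add: lc alt)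
    finally show ?thesis .
  qed
  define p where "p b c = br x b \<bullet> c" for b c
  define q where "q b c = br b c \<bullet> x" for b c
  have q_skew: "q c b = - q b c" for b c
    using skew[of b c] by (simp add: q_def)
  have D1: "?D b x \<bullet> c = (- p b c - p c b + q c b) / 2" for b c
    using skew[of b x] skew[of c x] by (simp add: lc p_def q_def)
  have D2: "?D x b \<bullet> c = (p b c - p c b + q c b) / 2" for b c
    using skew[of b c] skew[of c x] by (simp add: lc p_def q_def)
  have products: "(?D b x \<bullet> c) * (?D x b \<bullet> c) + p b c * (?D c x \<bullet> b) =
      (q b c)\<^sup>2 / 4 - (p b c)\<^sup>2 * (3/4) + (p c b)\<^sup>2 / 4 - p b c * p c b / 2
        + p b c * q b c / 2 + p c b * q b c / 2" for b c
    unfolding D1 D2 q_skew[of b c] by (simp add: power2_eq_square field_simps)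
  have second: "?D x (?D b x) \<bullet> b = - (\<Sum>c\<in>B. (?D b x \<bullet> c) * (?D x b \<bullet> c))" for b
  proof -
    have "?D x v \<bullet> b = - (?D x b \<bullet> v)" for v
    proof -
      have "br v b \<bullet> x = - (br b v \<bullet> x)" "br x b \<bullet> v = - (br b x \<bullet> v)"
        "br x v \<bullet> b = - (br v x \<bullet> b)"
        using skew[of v b] skew[of x b] skew[of x v] by simp_all
      then show ?thesis unfolding lc by (simp only: minus_divide_left) simp
    qed
    then show ?thesis
      using orthonormal_basis_parseval[OF B, of "?D b x" "?D x b"] by (simp add: inner_commute)
  qed
  have third: "?D (br b x) x \<bullet> b = - (\<Sum>c\<in>B. p b c * (?D c x \<bullet> b))" for b
  proof -
    have l: "linear (\<lambda>v. ?D v x)" by (rule linear_levi_civita_left[OF bil])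
    have "br b x = - br x b" by (rule skew)
    also have "br x b = (\<Sum>c\<in>B. (br x b \<bullet> c) *\<^sub>R c)"
      by (rule orthonormal_basis_expand[OF B])
    finally have "?D (br b x) x = - (\<Sum>c\<in>B. p b c *\<^sub>R ?D c x)"
      by (simp add: linear_neg[OF l] linear_sum[OF l] linear_cmul[OF l] p_def)
    then show ?thesis by (simp add: inner_sum_left)
  qed
  have expand: "ricci_form br x x = (\<Sum>b\<in>B. ?D b (?D x x) \<bullet> b)
      + (\<Sum>b\<in>B. \<Sum>c\<in>B. (?D b x \<bullet> c) * (?D x b \<bullet> c) + p b c * (?D c x \<bullet> b))"
    unfolding ricci_form_def trace_orthonormal_basis[OF B lin]
    by (simp add: riemann_curvature_def inner_diff_left second third sum.distrib sum_subtractf sum_negf)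
  have split: "(\<Sum>b\<in>B. \<Sum>c\<in>B. (?D b x \<bullet> c) * (?D x b \<bullet> c) + p b c * (?D c x \<bullet> b))
      = (\<Sum>b\<in>B. \<Sum>c\<in>B. (q b c)\<^sup>2) / 4 - (\<Sum>b\<in>B. \<Sum>c\<in>B. (p b c)\<^sup>2) * (3/4)
      + (\<Sum>b\<in>B. \<Sum>c\<in>B. (p c b)\<^sup>2) / 4 - (\<Sum>b\<in>B. \<Sum>c\<in>B. p b c * p c b) / 2
      + (\<Sum>b\<in>B. \<Sum>c\<in>B. p b c * q b c) / 2 + (\<Sum>b\<in>B. \<Sum>c\<in>B. p c b * q b c) / 2"
    unfolding products
    by (simp only: sum.distrib sum_subtractf sum_divide_distrib[symmetric] sum_distrib_right[symmetric])
  have swap1: "(\<Sum>b\<in>B. \<Sum>c\<in>B. (p c b)\<^sup>2) = (\<Sum>b\<in>B. \<Sum>c\<in>B. (p b c)\<^sup>2)"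
    by (rule sum.swap)
  have swap2: "(\<Sum>b\<in>B. \<Sum>c\<in>B. p c b * q b c) = - (\<Sum>b\<in>B. \<Sum>c\<in>B. p b c * q b c)"
  proof -
    have "(\<Sum>b\<in>B. \<Sum>c\<in>B. p c b * q b c) = (\<Sum>b\<in>B. \<Sum>c\<in>B. p b c * q c b)"
      by (rule sum.swap)
    also have "\<dots> = (\<Sum>b\<in>B. \<Sum>c\<in>B. - (p b c * q b c))"
      by (intro sum.cong refl) (metis q_skew mult_minus_right)
    finally show ?thesis by (simp add: sum_negf)
  qed
  have "ricci_form br x x = (\<Sum>b\<in>B. \<Sum>c\<in>B. (q b c)\<^sup>2) / 4
      - (\<Sum>b\<in>B. \<Sum>c\<in>B. (p b c)\<^sup>2) / 2 - (\<Sum>b\<in>B. \<Sum>c\<in>B. p b c * p c b) / 2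
      - br (mean_curvature br) x \<bullet> x"
    unfolding expand split swap1 swap2 first by simp
  then show ?thesis
    by (simp only: p_def q_def)
qed

section \<open>Coordinates of the brackets\<close>

lemma UNIV_9: "(UNIV :: 9 set) = {1, 2, 3, 4, 5, 6, 7, 8, 9}"
proof -
  have "card {1, 2, 3, 4, 5, 6, 7, 8, 9 :: 9} = CARD(9)"
    by simp
  then show ?thesis
    by (metis card_subset_eq finite subset_UNIV)
qed

lemma all_9: "(\<forall>i::9. P i) \<longleftrightarrow> P 1 \<and> P 2 \<and> P 3 \<and> P 4 \<and> P 5 \<and> P 6 \<and> P 7 \<and> P 8 \<and> P 9"
proof -
  have "(\<forall>i::9. P i) \<longleftrightarrow> (\<forall>i\<in>{1, 2, 3, 4, 5, 6, 7, 8, 9}. P i)"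
    unfolding UNIV_9[symmetric] by blast
  then show ?thesis by simp
qed

lemma sum_9: "sum f (UNIV :: 9 set) = f 1 + f 2 + f 3 + f 4 + f 5 + f 6 + f 7 + f 8 + f 9"
  unfolding UNIV_9 by (simp add: add.assoc)

lemma mu_nth:
  "mu t x y $ 1 = 0" "mu t x y $ 2 = 0" "mu t x y $ 3 = 0" "mu t x y $ 4 = 0"
  "mu t x y $ 5 = 0" "mu t x y $ 6 = 0"
  "mu t x y $ 7 = minor2 x y 5 4 + t * minor2 x y 3 6 + minor2 x y 1 2"
  "mu t x y $ 8 = minor2 x y 1 6 + t * minor2 x y 5 2"
  "mu t x y $ 9 = minor2 x y 3 2 + t * minor2 x y 1 4"
  by (simp_all add: mu_def axis_def)

lemma expand_9:
  fixes v :: "real ^ 9"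
  shows "v = (\<Sum>i\<in>UNIV. v $ i *\<^sub>R bv i)"
  by (simp add: vec_eq_iff axis_def if_distrib cong: if_cong)

lemma bv_nth: "bv i $ j = (if j = i then 1 else 0)"
  by (simp add: axis_def)

lemma linear_9:
  assumes "linear (f :: real ^ 9 \<Rightarrow> 'b::real_vector)"
  shows "f v = (\<Sum>i\<in>UNIV. v $ i *\<^sub>R f (bv i))"
  by (subst expand_9[of v]) (simp add: linear_sum[OF assms] linear_cmul[OF assms])

section \<open>The Pfaffian cubic and the isomorphism problem\<close>

text \<open>The radical of the 2-form obtained from the bracket by applying the functional with
  coefficients \<open>a, b, c\<close> on the centre.\<close>

definition form_radical :: "real \<Rightarrow> real \<Rightarrow> real \<Rightarrow> real \<Rightarrow> (real ^ 9) set" where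
  "form_radical t a b c =
     {x. \<forall>y. a * mu t x y $ 7 + b * mu t x y $ 8 + c * mu t x y $ 9 = 0}"

lemma form_radical_iff:
  "x \<in> form_radical t a b c \<longleftrightarrow>
    a * x $ 2 + b * x $ 6 + t * c * x $ 4 = 0 \<and> a * x $ 1 + t * b * x $ 5 + c * x $ 3 = 0 \<and>
    t * a * x $ 6 + c * x $ 2 = 0 \<and> a * x $ 5 + t * c * x $ 1 = 0 \<and>
    a * x $ 4 + t * b * x $ 2 = 0 \<and> t * a * x $ 3 + b * x $ 1 = 0"
  (is "_ \<longleftrightarrow> ?E1 = 0 \<and> ?E2 = 0 \<and> ?E3 = 0 \<and> ?E4 = 0 \<and> ?E5 = 0 \<and> ?E6 = 0")
proof -
  have form: "a * mu t x y $ 7 + b * mu t x y $ 8 + c * mu t x y $ 9 =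
      - ?E1 * y $ 1 + ?E2 * y $ 2 - ?E3 * y $ 3 + ?E4 * y $ 4 - ?E5 * y $ 5 + ?E6 * y $ 6" for y :: "real ^ 9"
    by (simp add: mu_nth minor2_def algebra_simps)
  have "?E1 = 0 \<and> ?E2 = 0 \<and> ?E3 = 0 \<and> ?E4 = 0 \<and> ?E5 = 0 \<and> ?E6 = 0"
    if "x \<in> form_radical t a b c"
  proof -
    have "- ?E1 * y $ 1 + ?E2 * y $ 2 - ?E3 * y $ 3 + ?E4 * y $ 4 - ?E5 * y $ 5 + ?E6 * y $ 6 = 0"
      for y :: "real ^ 9"
      using that unfolding form_radical_def form[symmetric] by blast
    from this[of "bv 1"] this[of "bv 2"] this[of "bv 3"] this[of "bv 4"] this[of "bv 5"] this[of "bv 6"]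
    show ?thesis by (simp add: bv_nth)
  qed
  moreover have "x \<in> form_radical t a b c"
    if "?E1 = 0" "?E2 = 0" "?E3 = 0" "?E4 = 0" "?E5 = 0" "?E6 = 0"
    unfolding form_radical_def mem_Collect_eq form that by simp
  ultimately show ?thesis by blast
qed

lemma center_mu:
  assumes "t \<noteq> 0"
  shows "(\<forall>y. mu t x y = 0) \<longleftrightarrow> (\<forall>i\<in>{1, 2, 3, 4, 5, 6}. x $ i = 0)"
proof
  assume "\<forall>y. mu t x y = 0"
  then have "x \<in> form_radical t 1 0 0" by (simp add: form_radical_def)
  then show "\<forall>i\<in>{1, 2, 3, 4, 5, 6}. x $ i = 0"
    using assms by (simp add: form_radical_iff)
next
  assume "\<forall>i\<in>{1, 2, 3, 4, 5, 6}. x $ i = 0"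
  then show "\<forall>y. mu t x y = 0"
    by (simp add: mu_def minor2_def)
qed

text \<open>The equations of the radical split into one system for the odd and one for the even
  coordinates. If \<open>a \<noteq> 0\<close>, each system reduces to a single equation for \<open>x\<^sub>1\<close> or \<open>x\<^sub>2\<close> whose coefficient is
  the quadratic factor of the Pfaffian.\<close>

lemma degenerate_form_conic:
  assumes x: "x \<in> form_radical t a b c" "\<exists>i\<in>{1, 2, 3, 4, 5, 6}. x $ i \<noteq> 0" and nz: "t \<noteq> 0" "a \<noteq> 0"
  shows "(1 + t ^ 3) * (b * c) = t * a\<^sup>2"
proof (rule ccontr)
  assume neq: "(1 + t ^ 3) * (b * c) \<noteq> t * a\<^sup>2"
  note E = x(1)[unfolded form_radical_iff]
  have "((1 + t ^ 3) * (b * c) - t * a\<^sup>2) * x $ 2 =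
      b * (t * a * x $ 6 + c * x $ 2) + t\<^sup>2 * c * (a * x $ 4 + t * b * x $ 2)
      - t * a * (a * x $ 2 + b * x $ 6 + t * c * x $ 4)"
    by (simp add: algebra_simps power2_eq_square power3_eq_cube)
  then have 2: "x $ 2 = 0" using E neq by simp
  have "((1 + t ^ 3) * (b * c) - t * a\<^sup>2) * x $ 1 =
      t\<^sup>2 * b * (a * x $ 5 + t * c * x $ 1) + c * (t * a * x $ 3 + b * x $ 1)
      - t * a * (a * x $ 1 + t * b * x $ 5 + c * x $ 3)"
    by (simp add: algebra_simps power2_eq_square power3_eq_cube)
  then have 1: "x $ 1 = 0" using E neq by simp
  show False
    using x(2) E nz 1 2 by auto
qed

text \<open>The conic \<open>(1 + t\<^sup>3) b c = t a\<^sup>2\<close> contains no line. If the pencil spanned by \<open>p\<close> and \<open>q\<close> left the line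
  \<open>a = 0\<close>, it would lie on the conic; its points with first coordinate \<open>p7\<close> then satisfy \<open>b c = const\<close>, and three of
  them show that \<open>b\<close> and \<open>c\<close> are constant, so that the pencil is degenerate.\<close>

lemma line_in_degenerate_cubic:
  fixes p7 p8 p9 q7 q8 q9 t :: real
  assumes t: "0 < t" and p7: "p7 \<noteq> 0"
    and indep: "\<And>y z. y * p7 + z * q7 = 0 \<Longrightarrow> y * p8 + z * q8 = 0 \<Longrightarrow> y * p9 + z * q9 = 0 \<Longrightarrow> z = 0"
    and conic: "\<And>y z. y * p7 + z * q7 \<noteq> 0 \<Longrightarrow>
      (1 + t ^ 3) * ((y * p8 + z * q8) * (y * p9 + z * q9)) = t * (y * p7 + z * q7)\<^sup>2"
  shows False
proof -
  define B where "B = p7 * q8 - q7 * p8"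
  define C where "C = p7 * q9 - q7 * p9"
  have k: "1 + t ^ 3 \<noteq> 0" using t by (smt (verit) zero_less_power)
  have pencil: "(1 + t ^ 3) * ((p8 + r * B) * (p9 + r * C)) = t * p7\<^sup>2" for r
  proof -
    have "(1 - r * q7) * p7 + (r * p7) * q7 = p7"
      "(1 - r * q7) * p8 + (r * p7) * q8 = p8 + r * B"
      "(1 - r * q7) * p9 + (r * p7) * q9 = p9 + r * C"
      by (simp_all add: B_def C_def algebra_simps)
    then show ?thesis using conic[of "1 - r * q7" "r * p7"] p7 by simp
  qed
  have 0: "(1 + t ^ 3) * (p8 * p9) = t * p7\<^sup>2" using pencil[of 0] by simp
  have nz: "p8 \<noteq> 0" "p9 \<noteq> 0" using 0 t p7 by auto
  have 1: "(p8 + B) * (p9 + C) = p8 * p9"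
    using pencil[of 1] 0 k by (metis mult_1 mult_left_cancel)
  have 2: "(p8 - B) * (p9 - C) = p8 * p9"
    using pencil[of "-1"] 0 k by (metis mult_left_cancel add_uminus_conv_diff mult_minus1)
  have "B * C = 0" "p8 * C + B * p9 = 0"
    using 1 2 by (simp_all add: algebra_simps)
  then have "B = 0" "C = 0" using nz by auto
  then show False
    using indep[of "- q7" p7] p7 by (simp add: B_def C_def)
qed

text \<open>The matrix \<open>(a, b; c, d)\<close> describes an isomorphism on \<open>\<langle>e\<^sub>3, e\<^sub>4\<rangle>\<close> and \<open>(a55, a56; a65, a66)\<close> on
  \<open>\<langle>e\<^sub>5, e\<^sub>6\<rangle>\<close>. The equations \<open>A\<close> say that it respects the identification of the two planes
  through the radicals, the equations \<open>br\<close> that it respects the pairing of the planes up to the factor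
  \<open>l\<close>. Eliminating the second matrix leaves a congruence up to scale between \<open>(0, t\<^sup>3; -1, 0)\<close> and
  \<open>(0, s\<^sup>3; -1, 0)\<close>. As \<open>s\<^sup>3 \<noteq> 1\<close>, its diagonal entries force \<open>a c = b d = 0\<close>; a diagonal matrix then
  gives \<open>s\<^sup>3 = t\<^sup>3\<close> and an antidiagonal one \<open>(s t)\<^sup>3 = 1\<close>.\<close>

lemma congruent_forms_rigid:
  fixes s t :: real
  assumes st: "1 < s" "1 < t" and nz: "\<beta> \<noteq> 0" "\<gamma> \<noteq> 0" "l \<noteq> 0"
    and A: "\<beta> * a65 = \<gamma> * s * t * c" "\<gamma> * t * a = s * \<beta> * a55"
      "\<beta> * t * a66 = s * \<gamma> * d" "\<gamma> * b = s * \<beta> * t * a56"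
    and br: "a55 * d - s * a65 * b = l" "s * a * a66 - c * a56 = t * l"
      "s * a * a65 = c * a55" "s * b * a66 = d * a56"
  shows "s = t"
proof -
  define \<kappa> where "\<kappa> = \<gamma> / \<beta>"
  have \<kappa>: "\<kappa> \<noteq> 0" "\<gamma> = \<kappa> * \<beta>" using nz by (auto simp: \<kappa>_def)
  have cubes: "s ^ 3 \<noteq> 1" "(s * t) ^ 3 \<noteq> 1"
  proof -
    have "1 < s ^ 3" "1 < (s * t) ^ 3"
      using st by (auto intro!: one_less_power less_1_mult)
    then show "s ^ 3 \<noteq> 1" "(s * t) ^ 3 \<noteq> 1" by auto
  qed
  have a65: "a65 = \<kappa> * s * t * c" and a55: "s * a55 = \<kappa> * t * a"
    and a66: "t * a66 = \<kappa> * s * d" and a56: "s * t * a56 = \<kappa> * b"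
    using A nz unfolding \<kappa>(2) by (simp_all add: mult_ac)
  have "(s ^ 3 - 1) * (\<kappa> * t * (a * c)) = s * (s * a * a65) - c * (s * a55)"
    unfolding a65 a55 by (simp add: algebra_simps power3_eq_cube)
  then have ac: "a * c = 0" using br(3) cubes \<kappa> st by simp
  have "(s ^ 3 - 1) * (\<kappa> * (b * d)) = s * s * b * (t * a66) - d * (s * t * a56)"
    unfolding a66 a56 by (simp add: algebra_simps power3_eq_cube)
  also have "\<dots> = s * t * (s * b * a66 - d * a56)" by (simp add: algebra_simps)
  finally have bd: "b * d = 0" using br(4) cubes \<kappa> st by simp
  have e1: "\<kappa> * t * (a * d) - \<kappa> * s ^ 3 * t * (b * c) = s * l"
  proof -
    have "s * l = (s * a55) * d - s * s * a65 * b" unfolding br(1)[symmetric] by (simp add: algebra_simps)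
    then show ?thesis unfolding a55 a65 by (simp add: algebra_simps power3_eq_cube)
  qed
  have e2: "\<kappa> * s ^ 3 * (a * d) - \<kappa> * (b * c) = t\<^sup>2 * (s * l)"
  proof -
    have "t\<^sup>2 * (s * l) = s * t * (t * l)"
      by (simp add: power2_eq_square)
    also have "\<dots> = s * s * a * (t * a66) - c * (s * t * a56)"
      unfolding br(2)[symmetric] by (simp add: algebra_simps)
    finally have "t\<^sup>2 * (s * l) = s * s * a * (t * a66) - c * (s * t * a56)" .
    then show ?thesis unfolding a66 a56 by (simp add: algebra_simps power3_eq_cube)
  qed
  have sl: "s * l \<noteq> 0" using st nz by simp
  consider "b * c = 0" | "a * d = 0" using ac bd by auto
  then show ?thesis
  proof cases
    case 1
    have e1': "\<kappa> * t * (a * d) = s * l" using e1 1 by simp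
    have "\<kappa> * (a * d) * s ^ 3 = t\<^sup>2 * (\<kappa> * t * (a * d))"
      unfolding e1' using e2 1 by (simp add: mult_ac)
    then have "\<kappa> * (a * d) * s ^ 3 = \<kappa> * (a * d) * t ^ 3"
      by (simp add: power2_eq_square power3_eq_cube mult_ac)
    moreover have "\<kappa> * (a * d) \<noteq> 0" using sl e1' by auto
    ultimately have "s ^ 3 = t ^ 3" by (metis mult_left_cancel)
    then show ?thesis using st by (simp add: power_eq_iff_eq_base)
  next
    case 2
    have e1': "- (\<kappa> * s ^ 3 * t * (b * c)) = s * l" using e1 2 by simp
    have "- (\<kappa> * (b * c)) = t\<^sup>2 * (- (\<kappa> * s ^ 3 * t * (b * c)))"
      unfolding e1' using e2 2 by simp
    then have "\<kappa> * (b * c) * 1 = \<kappa> * (b * c) * (s * t) ^ 3"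
      by (simp add: power2_eq_square power3_eq_cube mult_ac)
    moreover have "\<kappa> * (b * c) \<noteq> 0" using sl e1' by auto
    ultimately show ?thesis using cubes(2) by (metis mult_left_cancel)
  qed
qed

text \<open>Pulled back along the inverse \<open>h\<close> of an isomorphism \<open>g\<close>, the functionals \<open>e\<^sub>8\<^sup>*\<close> and \<open>e\<^sub>9\<^sup>*\<close> have coefficients \<open>p\<close> and \<open>q\<close>
  on the centre. They span a pencil of degenerate forms, so both vanish on \<open>e\<^sub>7\<close>. Comparing the radicals
  of this pencil with those of its image constrains the coordinates \<open>A\<close> of \<open>g\<close> on \<open>\<langle>e\<^sub>3, \<dots>, e\<^sub>6\<rangle>\<close> until
  \<open>congruent_forms_rigid\<close> applies.\<close>

lemma mu_isomorphic_imp_eq: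
  assumes st: "1 < s" "1 < t" and iso: "lie_isomorphic (mu t) (mu s)"
  shows "s = t"
proof -
  obtain g where lin: "linear g" and bij: "bij g" and hom: "\<And>x y. g (mu t x y) = mu s (g x) (g y)"
    using iso unfolding lie_isomorphic_def by blast
  define h where "h = inv g"
  have gh: "g (h x) = x" and hg: "h (g x) = x" for x
    using bij by (simp_all add: h_def bij_is_surj surj_f_inv_f bij_is_inj)
  have lin_h: "linear h"
  proof (rule linearI)
    show "h (x + y) = h x + h y" for x y
      by (metis gh hg linear_add[OF lin])
    show "h (r *\<^sub>R x) = r *\<^sub>R h x" for r x
      by (metis gh hg linear_cmul[OF lin])
  qed
  have hom_h: "h (mu s x y) = mu t (h x) (h y)" for x y
    by (metis gh hg hom)
  have t0: "t \<noteq> 0" and s0: "s \<noteq> 0" using st by auto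
  have center: "(\<forall>i\<in>{1, 2, 3, 4, 5, 6}. g x $ i = 0) \<longleftrightarrow> (\<forall>i\<in>{1, 2, 3, 4, 5, 6}. x $ i = 0)" for x
  proof -
    have "(\<forall>y. mu s (g x) y = 0) \<longleftrightarrow> (\<forall>y. mu t x y = 0)"
      by (metis gh hg hom linear_0[OF lin])
    then show ?thesis unfolding center_mu[OF t0] center_mu[OF s0] .
  qed
  define p where "p k = h (bv k) $ 8" for k
  define q where "q k = h (bv k) $ 9" for k
  have h_mu: "h (mu s x y) $ i = mu s x y $ 7 * h (bv 7) $ i + mu s x y $ 8 * h (bv 8) $ i
      + mu s x y $ 9 * h (bv 9) $ i" for x y i
    by (subst linear_9[OF lin_h]) (simp add: sum_9 mu_nth(1-6))
  \<comment> \<open>Pulling the functional \<open>y e\<^sub>8\<^sup>* + z e\<^sub>9\<^sup>*\<close> back along \<open>h\<close> transports its radical.\<close>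
  have transport: "g r \<in> form_radical s (y * p 7 + z * q 7) (y * p 8 + z * q 8) (y * p 9 + z * q 9)"
    if "r \<in> form_radical t 0 y z" for r y z
  proof -
    have "(y * p 7 + z * q 7) * mu s (g r) w $ 7 + (y * p 8 + z * q 8) * mu s (g r) w $ 8
        + (y * p 9 + z * q 9) * mu s (g r) w $ 9 = 0" for w
    proof -
      have "y * h (mu s (g r) w) $ 8 + z * h (mu s (g r) w) $ 9 = 0"
        using that unfolding hom_h hg form_radical_def by auto
      then show ?thesis
        unfolding h_mu p_def q_def by (simp add: algebra_simps)
    qed
    then show ?thesis unfolding form_radical_def by blast
  qed
  \<comment> \<open>The vectors \<open>R y z a b\<close> sweep out the radical of \<open>y e\<^sub>8\<^sup>* + z e\<^sub>9\<^sup>* \<noteq> 0\<close> modulo the centre.\<close>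
  define R where "R y z a b = (t * y * a) *\<^sub>R bv 3 + (y * b) *\<^sub>R bv 4 - (z * a) *\<^sub>R bv 5 - (t * z * b) *\<^sub>R bv 6"
    for y z a b
  have R: "R y z a b \<in> form_radical t 0 y z" for y z a b
    by (simp add: form_radical_iff R_def bv_nth)
  have indep: "y = 0 \<and> z = 0"
    if "y * p 7 + z * q 7 = 0" "y * p 8 + z * q 8 = 0" "y * p 9 + z * q 9 = 0" for y z
  proof -
    have 0: "y * mu t u v $ 8 + z * mu t u v $ 9 = 0" for u v
    proof -
      have "mu t u v = h (mu s (g u) (g v))" by (simp add: hom_h hg)
      then have "y * mu t u v $ 8 + z * mu t u v $ 9 =
          mu s (g u) (g v) $ 7 * (y * p 7 + z * q 7) + mu s (g u) (g v) $ 8 * (y * p 8 + z * q 8)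
          + mu s (g u) (g v) $ 9 * (y * p 9 + z * q 9)"
        by (simp add: h_mu p_def q_def algebra_simps)
      then show ?thesis using that by simp
    qed
    show ?thesis
      using 0[of "bv 1" "bv 6"] 0[of "bv 3" "bv 2"] by (simp add: mu_basis bv_nth)
  qed
  have R_noncentral: "\<exists>i\<in>{1, 2, 3, 4, 5, 6}. g (R y z 1 1) $ i \<noteq> 0" if "y \<noteq> 0 \<or> z \<noteq> 0" for y z
    using that t0 center[of "R y z 1 1"] by (auto simp: R_def bv_nth)
  have conic: "(1 + s ^ 3) * ((y * p 8 + z * q 8) * (y * p 9 + z * q 9)) = s * (y * p 7 + z * q 7)\<^sup>2"
    if "y * p 7 + z * q 7 \<noteq> 0" for y z
  proof -
    have "y \<noteq> 0 \<or> z \<noteq> 0" using that by auto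
    from degenerate_form_conic[OF transport[OF R] R_noncentral[OF this] s0 that] show ?thesis .
  qed
  have p7: "p 7 = 0"
  proof (rule ccontr)
    assume "p 7 \<noteq> 0"
    then show False
    proof (rule line_in_degenerate_cubic[of s "p 7" "q 7" "p 8" "q 8" "p 9" "q 9", rotated])
      show "z = 0" if "y * p 7 + z * q 7 = 0" "y * p 8 + z * q 8 = 0" "y * p 9 + z * q 9 = 0" for y z
        using indep[OF that] by simp
      show "(1 + s ^ 3) * ((y * p 8 + z * q 8) * (y * p 9 + z * q 9)) = s * (y * p 7 + z * q 7)\<^sup>2"
        if "y * p 7 + z * q 7 \<noteq> 0" for y z
        using conic[OF that] .
    qed (use st in simp)
  qed
  have q7: "q 7 = 0"
  proof (rule ccontr)
    assume "q 7 \<noteq> 0"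
    then show False
    proof (rule line_in_degenerate_cubic[of s "q 7" "p 7" "q 8" "p 8" "q 9" "p 9", rotated])
      show "z = 0" if "y * q 7 + z * p 7 = 0" "y * q 8 + z * p 8 = 0" "y * q 9 + z * p 9 = 0" for y z
        using indep[of z y] that by (simp add: add.commute)
      show "(1 + s ^ 3) * ((y * q 8 + z * p 8) * (y * q 9 + z * p 9)) = s * (y * q 7 + z * p 7)\<^sup>2"
        if "y * q 7 + z * p 7 \<noteq> 0" for y z
        using conic[of z y] that by (simp add: add.commute)
    qed (use st in simp)
  qed
  obtain l where l: "l \<noteq> 0" "g (bv 7) = l *\<^sub>R bv 7"
  proof -
    have c: "\<forall>i\<in>{1, 2, 3, 4, 5, 6}. h (bv 7) $ i = 0"
      using center[of "h (bv 7)"] by (simp add: gh bv_nth)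
    define m where "m = h (bv 7) $ 7"
    have "h (bv 7) = m *\<^sub>R bv 7"
      unfolding vec_eq_iff all_9 using c p7 q7 by (simp add: bv_nth p_def q_def m_def)
    then have e: "bv 7 = m *\<^sub>R g (bv 7)"
      using gh[of "bv 7"] by (simp add: linear_cmul[OF lin])
    then have m: "m \<noteq> 0" by auto
    have "inverse m *\<^sub>R bv 7 = inverse m *\<^sub>R (m *\<^sub>R g (bv 7))"
      by (rule arg_cong[OF e])
    also have "\<dots> = g (bv 7)" using m by simp
    finally show thesis
      using that[of "inverse m"] m by simp
  qed
  have rad: "g (R y z a b) \<in> form_radical s 0 (y * p 8 + z * q 8) (y * p 9 + z * q 9)" for y z a b
    using transport[OF R, of y z a b] p7 q7 by simp
  define A where "A i j = g (bv j) $ i" for i j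
  have gR: "g (R y z a b) $ i = t * y * a * A i 3 + y * b * A i 4 - z * a * A i 5 - t * z * b * A i 6" for y z a b i
    by (simp add: R_def linear_add[OF lin] linear_diff[OF lin] linear_cmul[OF lin] A_def)
  note E = rad[unfolded form_radical_iff gR]
  have E34: "p 8 * A 6 3 + s * p 9 * A 4 3 = 0" "s * p 8 * A 5 3 + p 9 * A 3 3 = 0"
    "p 8 * A 6 4 + s * p 9 * A 4 4 = 0" "s * p 8 * A 5 4 + p 9 * A 3 4 = 0"
    using E[where y = 1 and z = 0 and a = "1 / t" and b = 0] E[where y = 1 and z = 0 and a = 0 and b = 1] t0 by simp_all
  have E56: "q 8 * A 6 5 + s * q 9 * A 4 5 = 0" "s * q 8 * A 5 5 + q 9 * A 3 5 = 0"
    "q 8 * A 6 6 + s * q 9 * A 4 6 = 0" "s * q 8 * A 5 6 + q 9 * A 3 6 = 0"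
    using E[where y = 0 and z = 1 and a = "- 1" and b = 0] E[where y = 0 and z = 1 and a = 0 and b = "- 1 / t"] t0 by simp_all
  have A12: "A 1 j = 0" "A 2 j = 0" if j: "j \<in> {3, 4, 5, 6}" for j
  proof -
    have p: "p 8 \<noteq> 0 \<or> p 9 \<noteq> 0" and q: "q 8 \<noteq> 0 \<or> q 9 \<noteq> 0"
      using indep[of 1 0] indep[of 0 1] p7 q7 by auto
    have "A 1 3 = 0 \<and> A 2 3 = 0" using E[where y = 1 and z = 0 and a = "1 / t" and b = 0] p s0 t0 by auto
    moreover have "A 1 4 = 0 \<and> A 2 4 = 0" using E[where y = 1 and z = 0 and a = 0 and b = 1] p s0 t0 by auto
    moreover have "A 1 5 = 0 \<and> A 2 5 = 0" using E[where y = 0 and z = 1 and a = "- 1" and b = 0] q s0 t0 by auto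
    moreover have "A 1 6 = 0 \<and> A 2 6 = 0" using E[where y = 0 and z = 1 and a = 0 and b = "- 1 / t"] q s0 t0 by auto
    ultimately show "A 1 j = 0" "A 2 j = 0" using j by auto
  qed
  have mixed: "(p 8 + q 8) * (t * A 6 3 - A 6 5) + s * (p 9 + q 9) * (t * A 4 3 - A 4 5) = 0"
    "s * (p 8 + q 8) * (t * A 5 3 - A 5 5) + (p 9 + q 9) * (t * A 3 3 - A 3 5) = 0"
    "(p 8 + q 8) * (A 6 4 - t * A 6 6) + s * (p 9 + q 9) * (A 4 4 - t * A 4 6) = 0"
    "s * (p 8 + q 8) * (A 5 4 - t * A 5 6) + (p 9 + q 9) * (A 3 4 - t * A 3 6) = 0"
    using E[where y = 1 and z = 1 and a = 1 and b = 0] E[where y = 1 and z = 1 and a = 0 and b = 1] by simp_all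
  have bracket: "mu t (bv i) (bv j) $ 7 * l =
      A 5 i * A 4 j - A 4 i * A 5 j + s * (A 3 i * A 6 j - A 6 i * A 3 j)"
    if "i \<in> {3, 4, 5, 6}" "j \<in> {3, 4, 5, 6}" "mu t (bv i) (bv j) = mu t (bv i) (bv j) $ 7 *\<^sub>R bv 7" for i j
  proof -
    have "g (mu t (bv i) (bv j)) = mu t (bv i) (bv j) $ 7 *\<^sub>R (l *\<^sub>R bv 7)"
      unfolding l(2)[symmetric] by (metis that(3) linear_cmul[OF lin])
    then have "g (mu t (bv i) (bv j)) $ 7 = mu t (bv i) (bv j) $ 7 * l"
      by (simp add: bv_nth)
    then show ?thesis
      using A12[OF that(1)] A12[OF that(2)]
      by (simp add: hom mu_nth minor2_def flip: A_def)
  qed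
  have br: "A 5 5 * A 4 4 - A 4 5 * A 5 4 + s * (A 3 5 * A 6 4 - A 6 5 * A 3 4) = l"
    "A 5 3 * A 4 6 - A 4 3 * A 5 6 + s * (A 3 3 * A 6 6 - A 6 3 * A 3 6) = t * l"
    "A 5 3 * A 4 4 - A 4 3 * A 5 4 + s * (A 3 3 * A 6 4 - A 6 3 * A 3 4) = 0"
    "A 5 5 * A 4 6 - A 4 5 * A 5 6 + s * (A 3 5 * A 6 6 - A 6 5 * A 3 6) = 0"
    "A 5 3 * A 4 5 - A 4 3 * A 5 5 + s * (A 3 3 * A 6 5 - A 6 3 * A 3 5) = 0"
    "A 5 4 * A 4 6 - A 4 4 * A 5 6 + s * (A 3 4 * A 6 6 - A 6 4 * A 3 6) = 0"
    using bracket[of 5 4] bracket[of 3 6] bracket[of 3 4] bracket[of 5 6] bracket[of 3 5] bracket[of 4 6]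
    by (simp_all add: mu_basis mu_basis_zero doubleton_eq_iff bv_nth)
  have central: "\<alpha> = 0 \<and> \<beta> = 0"
    if "i \<noteq> j" "i \<in> {3, 4, 5, 6}" "j \<in> {3, 4, 5, 6}" "\<forall>k\<in>{3, 4, 5, 6}. \<alpha> * A k i + \<beta> * A k j = 0" for \<alpha> \<beta> i j
  proof -
    have "g (\<alpha> *\<^sub>R bv i + \<beta> *\<^sub>R bv j) $ k = \<alpha> * A k i + \<beta> * A k j" for k
      by (simp add: linear_add[OF lin] linear_cmul[OF lin] A_def)
    then have "\<forall>k\<in>{1, 2, 3, 4, 5, 6}. (\<alpha> *\<^sub>R bv i + \<beta> *\<^sub>R bv j) $ k = 0"
      using that(4) A12[OF that(2)] A12[OF that(3)] center[of "\<alpha> *\<^sub>R bv i + \<beta> *\<^sub>R bv j"] by simp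
    then show ?thesis using that(1-3) by (auto simp: bv_nth)
  qed
  \<comment> \<open>Where both coordinates of the functional are nonzero, its radical is not abelian.\<close>
  have isotropic: "y = 0 \<or> z = 0"
    if ij: "i \<noteq> j" "i \<in> {3, 4, 5, 6}" "j \<in> {3, 4, 5, 6}"
      and rad: "y * A 6 i + s * z * A 4 i = 0" "s * y * A 5 i + z * A 3 i = 0"
        "y * A 6 j + s * z * A 4 j = 0" "s * y * A 5 j + z * A 3 j = 0"
      and br: "A 5 i * A 4 j - A 4 i * A 5 j + s * (A 3 i * A 6 j - A 6 i * A 3 j) = 0" for i j y z
  proof (rule ccontr)
    assume nz: "\<not> (y = 0 \<or> z = 0)"
    have z_eq: "y * A 6 i = - s * z * A 4 i" "s * y * A 5 i = - z * A 3 i"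
      "y * A 6 j = - s * z * A 4 j" "s * y * A 5 j = - z * A 3 j"
      using rad by linarith+
    have "- (z * (1 + s ^ 3)) * (A 3 i * A 4 j - A 4 i * A 3 j) =
        (s * y * A 5 i) * A 4 j - A 4 i * (s * y * A 5 j) + s\<^sup>2 * (A 3 i * (y * A 6 j) - (y * A 6 i) * A 3 j)"
      unfolding z_eq by (simp add: algebra_simps power2_eq_square power3_eq_cube)
    also have "\<dots> = s * y * (A 5 i * A 4 j - A 4 i * A 5 j + s * (A 3 i * A 6 j - A 6 i * A 3 j))"
      by (simp add: algebra_simps power2_eq_square)
    also have "\<dots> = 0" using br by simp
    finally have m: "A 3 i * A 4 j = A 4 i * A 3 j"
      using nz st by (simp add: add_pos_pos less_imp_neq[symmetric])
    have five_six: "\<alpha> * A 5 i + \<beta> * A 5 j = 0 \<and> \<alpha> * A 6 i + \<beta> * A 6 j = 0"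
      if "\<alpha> * A 3 i + \<beta> * A 3 j = 0" "\<alpha> * A 4 i + \<beta> * A 4 j = 0" for \<alpha> \<beta>
    proof -
      have "s * y * (\<alpha> * A 5 i + \<beta> * A 5 j) = \<alpha> * (s * y * A 5 i) + \<beta> * (s * y * A 5 j)"
        by (simp add: algebra_simps)
      also have "\<dots> = - z * (\<alpha> * A 3 i + \<beta> * A 3 j)"
        unfolding z_eq by (simp add: algebra_simps)
      finally have 5: "s * y * (\<alpha> * A 5 i + \<beta> * A 5 j) = 0" using that by simp
      have "y * (\<alpha> * A 6 i + \<beta> * A 6 j) = \<alpha> * (y * A 6 i) + \<beta> * (y * A 6 j)"
        by (simp add: algebra_simps)
      also have "\<dots> = - s * z * (\<alpha> * A 4 i + \<beta> * A 4 j)"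
        unfolding z_eq by (simp add: algebra_simps)
      finally have 6: "y * (\<alpha> * A 6 i + \<beta> * A 6 j) = 0" using that by simp
      show ?thesis using 5 6 nz s0 by simp
    qed
    have "A 4 j = 0 \<and> - A 4 i = 0"
      by (rule central[OF ij]) (use five_six[of "A 4 j" "- A 4 i"] m in \<open>simp add: mult_ac\<close>)
    moreover have "A 3 j = 0 \<and> - A 3 i = 0"
      by (rule central[OF ij]) (use five_six[of "A 3 j" "- A 3 i"] m in \<open>simp add: mult_ac\<close>)
    ultimately have "(1::real) = 0 \<and> (0::real) = 0"
      by (intro central[OF ij]) (use five_six[of 1 0] in simp)
    then show False by simp
  qed
  have dual: "p 8 \<noteq> 0 \<or> p 9 \<noteq> 0" "p 8 \<noteq> 0 \<or> q 8 \<noteq> 0" "p 9 \<noteq> 0 \<or> q 9 \<noteq> 0"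
  proof -
    show "p 8 \<noteq> 0 \<or> p 9 \<noteq> 0"
      using indep[of 1 0] p7 by auto
    show "p 8 \<noteq> 0 \<or> q 8 \<noteq> 0"
    proof (rule ccontr)
      assume neg: "\<not> ?thesis"
      then have "q 9 = 0 \<and> - p 9 = 0" using neg by (intro indep) (simp_all add: p7 q7)
      then show False using neg indep[of 1 0] p7 by simp
    qed
    show "p 9 \<noteq> 0 \<or> q 9 \<noteq> 0"
    proof (rule ccontr)
      assume neg: "\<not> ?thesis"
      then have "q 8 = 0 \<and> - p 8 = 0" using neg by (intro indep) (simp_all add: p7 q7)
      then show False using neg indep[of 1 0] p7 by simp
    qed
  qed
  \<comment> \<open>So \<open>\<langle>e\<^sub>3, e\<^sub>4\<rangle>\<close> and \<open>\<langle>e\<^sub>5, e\<^sub>6\<rangle>\<close>, which are abelian, go to the same two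
    planes modulo the centre, in one order or the other.\<close>
  have "p 8 = 0 \<or> p 9 = 0" using isotropic[of 3 4, OF _ _ _ E34 br(3)] by simp
  moreover have "q 8 = 0 \<or> q 9 = 0" using isotropic[of 5 6, OF _ _ _ E56 br(4)] by simp
  ultimately consider "p 9 = 0" "q 8 = 0" "p 8 \<noteq> 0" "q 9 \<noteq> 0" | "p 8 = 0" "q 9 = 0" "p 9 \<noteq> 0" "q 8 \<noteq> 0"
    using dual by blast
  then show ?thesis
  proof cases
    case 1
    have z: "A 6 3 = 0" "A 5 3 = 0" "A 6 4 = 0" "A 5 4 = 0" "A 4 5 = 0" "A 3 5 = 0" "A 4 6 = 0" "A 3 6 = 0"
      using E34 E56 1 s0 by simp_all
    show ?thesis
      by (rule congruent_forms_rigid[OF st 1(3,4) l(1), where a = "A 3 3" and b = "A 3 4" and c = "A 4 3"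
            and d = "A 4 4" and ?a55.0 = "A 5 5" and ?a56.0 = "A 5 6" and ?a65.0 = "A 6 5" and ?a66.0 = "A 6 6"])
        (use mixed br 1 z in \<open>simp_all add: algebra_simps\<close>)
  next
    case 2
    have z: "A 4 3 = 0" "A 3 3 = 0" "A 4 4 = 0" "A 3 4 = 0" "A 6 5 = 0" "A 5 5 = 0" "A 6 6 = 0" "A 5 6 = 0"
      using E34 E56 2 s0 by simp_all
    \<comment> \<open>Composing with the automorphism \<open>e\<^sub>1 \<leftrightarrow> e\<^sub>2\<close>, \<open>e\<^sub>3 \<leftrightarrow> e\<^sub>6\<close>, \<open>e\<^sub>4 \<leftrightarrow> e\<^sub>5\<close>, which negates \<open>e\<^sub>7\<close>,
      reduces this case to the previous one.\<close>
    have l': "- l \<noteq> 0" using l by simp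
    show ?thesis
      by (rule congruent_forms_rigid[OF st 2(3,4) l', where a = "A 6 3" and b = "A 6 4" and c = "A 5 3"
            and d = "A 5 4" and ?a55.0 = "A 4 5" and ?a56.0 = "A 4 6" and ?a65.0 = "A 3 5" and ?a66.0 = "A 3 6"])
        (use mixed br 2 z in \<open>simp_all add: algebra_simps\<close>)
  qed
qed

section \<open>Derivations and the failure of a grading\<close>

text \<open>Up to maps into the centre, a derivation is diagonal. Comparing coefficients in the
  derivation identity, every other entry is either zero by one or two of the equations or lies on a cycle of
  three entries in which each is \<open>\<plusminus> t\<close> times the next.\<close>

lemma derivation_mu:
  fixes \<delta> :: "real ^ 9 \<Rightarrow> real ^ 9"
  assumes t: "1 < t" and lin: "linear \<delta>"
    and der: "\<And>x y. \<delta> (mu t x y) = mu t (\<delta> x) y + mu t x (\<delta> y)"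
  obtains d :: "9 \<Rightarrow> real" where
    "\<And>v i. i \<in> {1, 2, 3, 4, 5, 6} \<Longrightarrow> \<delta> v $ i = d i * v $ i"
    "\<And>v i. \<forall>j\<in>{1, 2, 3, 4, 5, 6}. v $ j = 0 \<Longrightarrow> \<delta> v $ i = d i * v $ i"
    "d 7 = d 1 + d 2" "d 7 = d 3 + d 6" "d 7 = d 4 + d 5"
    "d 8 = d 1 + d 6" "d 8 = d 2 + d 5" "d 9 = d 1 + d 4" "d 9 = d 2 + d 3"
proof -
  define D where "D i j = \<delta> (bv j) $ i" for i j
  have t0: "t \<noteq> 0" and t3: "t * (t * t) \<noteq> 1" and t3': "1 + t * (t * t) \<noteq> 0"
  proof -
    have "1 < t * t" using t by (simp add: less_1_mult)
    then have "1 < t * (t * t)" using t by (simp add: less_1_mult)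
    then show "t \<noteq> 0" "t * (t * t) \<noteq> 1" "1 + t * (t * t) \<noteq> 0" using t by auto
  qed
  have ext: "\<delta> v $ i = (\<Sum>j\<in>UNIV. v $ j * D i j)" for v i
    by (subst linear_9[OF lin]) (simp add: D_def)
  have eq: "(\<Sum>l\<in>UNIV. mu t (bv i) (bv j) $ l * D k l)
      = mu t (\<delta> (bv i)) (bv j) $ k + mu t (bv i) (\<delta> (bv j)) $ k" for i j k
    by (simp add: ext[symmetric] der)
  have \<delta>_bv: "\<delta> (bv i) $ k = D k i" for i k
    by (simp add: D_def)
  note simps = sum_9 mu_nth minor2_def bv_nth \<delta>_bv
  have E12: "D 1 7 = 0" "D 2 7 = 0" "D 3 7 = 0" "D 4 7 = 0" "D 5 7 = 0" "D 6 7 = 0"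
    "D 7 7 = D 1 1 + D 2 2" "D 8 7 = t * D 5 1 + D 6 2" "D 9 7 = D 3 1 + t * D 4 2"
    using eq[of 1 2 1] eq[of 1 2 2] eq[of 1 2 3] eq[of 1 2 4] eq[of 1 2 5] eq[of 1 2 6]
      eq[of 1 2 7] eq[of 1 2 8] eq[of 1 2 9] by (simp_all add: simps)
  have E14: "t * D 1 9 = 0" "t * D 2 9 = 0" "t * D 3 9 = 0" "t * D 4 9 = 0" "t * D 5 9 = 0" "t * D 6 9 = 0"
    "t * D 7 9 = D 2 4 + D 5 1" "t * D 8 9 = D 6 4" "t * D 9 9 = t * (D 1 1 + D 4 4)"
    using eq[of 1 4 1] eq[of 1 4 2] eq[of 1 4 3] eq[of 1 4 4] eq[of 1 4 5] eq[of 1 4 6]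
      eq[of 1 4 7] eq[of 1 4 8] eq[of 1 4 9] by (simp_all add: simps algebra_simps)
  have E16: "D 1 8 = 0" "D 2 8 = 0" "D 3 8 = 0" "D 4 8 = 0" "D 5 8 = 0" "D 6 8 = 0"
    "D 7 8 = D 2 6 + t * D 3 1" "D 8 8 = D 1 1 + D 6 6" "D 9 8 = t * D 4 6"
    using eq[of 1 6 1] eq[of 1 6 2] eq[of 1 6 3] eq[of 1 6 4] eq[of 1 6 5] eq[of 1 6 6]
      eq[of 1 6 7] eq[of 1 6 8] eq[of 1 6 9] by (simp_all add: simps algebra_simps)
  have E1: "D 2 3 = t * D 6 1" "D 6 3 = 0" "D 2 1 = t * D 4 3"
    "D 2 5 = D 4 1" "D 6 5 = t * D 2 1" "t * D 4 5 = 0"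
    using eq[of 1 3 7] eq[of 1 3 8] eq[of 1 3 9] eq[of 1 5 7] eq[of 1 5 8] eq[of 1 5 9]
    by (simp_all add: simps algebra_simps)
  have E2: "D 7 9 = D 1 3 + t * D 6 2" "D 8 9 = t * D 5 3" "D 9 9 = D 2 2 + D 3 3"
    "D 1 4 = D 5 2" "t * D 5 4 = 0" "D 3 4 = t * D 1 2"
    "t * D 7 8 = D 1 5 + D 4 2" "t * D 8 8 = t * (D 2 2 + D 5 5)" "t * D 9 8 = D 3 5"
    "D 1 6 = t * D 3 2" "D 1 2 = t * D 5 6" "D 3 6 = 0"
    using eq[of 2 3 7] eq[of 2 3 8] eq[of 2 3 9] eq[of 2 4 7] eq[of 2 4 8] eq[of 2 4 9]
      eq[of 2 5 7] eq[of 2 5 8] eq[of 2 5 9] eq[of 2 6 7] eq[of 2 6 8] eq[of 2 6 9]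
    by (simp_all add: simps algebra_simps)
  have E3_1: "D 5 3 = - t * D 6 4"
    using eq[of 3 4 7] by (simp add: simps algebra_simps)
  have E3_2: "D 2 4 = - t * D 1 3"
    using eq[of 3 4 9] by (simp add: simps algebra_simps)
  have E3_3: "D 4 3 = t * D 6 5"
    using eq[of 3 5 7] by (simp add: simps algebra_simps)
  have E3_4: "t * D 2 3 = 0"
    using eq[of 3 5 8] by (simp add: simps algebra_simps)
  have E3_5: "D 2 5 = 0"
    using eq[of 3 5 9] by (simp add: simps algebra_simps)
  have E3_6: "t * D 7 7 = t * (D 3 3 + D 6 6)"
    using eq[of 3 6 7] by (simp add: simps algebra_simps)
  have E3_7: "t * D 8 7 = D 1 3"
    using eq[of 3 6 8] by (simp add: simps algebra_simps)
  have E3_8: "t * D 9 7 = D 2 6"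
    using eq[of 3 6 9] by (simp add: simps algebra_simps)
  note E3 = E3_1 E3_2 E3_3 E3_4 E3_5 E3_6 E3_7 E3_8
  have E4_1: "D 7 7 = D 4 4 + D 5 5"
    using eq[of 4 5 7] by (simp add: simps algebra_simps)
  have E4_2: "D 8 7 = t * D 2 4"
    using eq[of 4 5 8] by (simp add: simps algebra_simps)
  have E4_3: "D 9 7 = t * D 1 5"
    using eq[of 4 5 9] by (simp add: simps algebra_simps)
  have E4_4: "D 5 6 = t * D 3 4"
    using eq[of 4 6 7] by (simp add: simps algebra_simps)
  have E4_5: "D 1 4 = 0"
    using eq[of 4 6 8] by (simp add: simps algebra_simps)
  have E4_6: "t * D 1 6 = 0"
    using eq[of 4 6 9] by (simp add: simps algebra_simps)
  have E4_7: "D 4 6 = - t * D 3 5"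
    using eq[of 5 6 7] by (simp add: simps algebra_simps)
  have E4_8: "D 1 5 = - t * D 2 6"
    using eq[of 5 6 8] by (simp add: simps algebra_simps)
  note E4 = E4_1 E4_2 E4_3 E4_4 E4_5 E4_6 E4_7 E4_8
  \<comment> \<open>The two kinds of cycles: the products \<open>t\<^sup>3\<close> and \<open>-t\<^sup>3\<close> of their factors differ from 1.\<close>
  have cycle: "x = 0 \<and> y = 0 \<and> z = 0" if "x = t * y" "y = t * z" "z = t * x" for x y z
  proof -
    have "x = t * (t * (t * x))" using that by metis
    then have "(t * (t * t) - 1) * x = 0" by (simp add: algebra_simps)
    then have x: "x = 0" using t3 by simp
    then have z: "z = 0" using that(3) by simp
    then have "y = 0" using that(2) by simp
    with x z show ?thesis by simp
  qed
  have skew: "x = 0 \<and> y = 0 \<and> z = 0" if "x = t * y" "y = - t * z" "t * x = z" for x y z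
  proof -
    have "x = t * (- t * (t * x))" using that by metis
    then have "(1 + t * (t * t)) * x = 0" by (simp add: algebra_simps)
    then have x: "x = 0" using t3' by simp
    then have z: "z = 0" using that(3) by simp
    then have "y = 0" using that(2) by simp
    with x z show ?thesis by simp
  qed
  have z1: "D 2 3 = 0" "D 2 5 = 0" "D 4 5 = 0" "D 6 3 = 0" "D 5 4 = 0" "D 3 6 = 0" "D 1 4 = 0" "D 1 6 = 0"
    using E1(2,6) E2(5,12) E3(4,5) E4(5,6) t0 by auto
  have z1': "D 6 1 = 0" "D 4 1 = 0" "D 5 2 = 0" "D 3 2 = 0"
    using E1(1,4) E2(4,10) z1 t0 by simp_all
  have z2: "D 2 1 = 0" "D 4 3 = 0" "D 6 5 = 0"
    using cycle[OF E1(3) E3(3) E1(5)] by auto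
  have z3: "D 1 2 = 0" "D 5 6 = 0" "D 3 4 = 0"
    using cycle[OF E2(11) E4(4) E2(6)] by auto
  have z4: "D 8 9 = 0" "D 5 3 = 0" "D 6 4 = 0"
    using skew[OF E2(2) E3(1) E14(8)] by auto
  have z5: "D 9 8 = 0" "D 4 6 = 0" "D 3 5 = 0"
    using skew[OF E16(9) E4(7) E2(9)] by auto
  have z6: "D 8 7 = 0" "D 2 4 = 0" "D 1 3 = 0"
    using skew[OF E4(2) E3(2) E3(7)] by auto
  have z7: "D 9 7 = 0" "D 1 5 = 0" "D 2 6 = 0"
    using skew[OF E4(3) E4(8) E3(8)] by auto
  have "D 7 9 = t * D 6 2" "D 6 2 = - t * D 5 1" "t * D 7 9 = D 5 1"
    using E2(1) E12(8) E14(7) z6 by simp_all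
  from skew[OF this] have z8: "D 7 9 = 0" "D 6 2 = 0" "D 5 1 = 0"
    by auto
  have "D 7 8 = t * D 3 1" "D 3 1 = - t * D 4 2" "t * D 7 8 = D 4 2"
    using E16(7) E12(9) E2(7) z7 by simp_all
  from skew[OF this] have z9: "D 7 8 = 0" "D 3 1 = 0" "D 4 2 = 0"
    by auto
  have z10: "D i 9 = 0" if "i \<in> {1, 2, 3, 4, 5, 6}" for i
    using that E14 t0 by auto
  show ?thesis
  proof (rule that[of "\<lambda>i. D i i"])
    show "\<delta> v $ i = D i i * v $ i" if "i \<in> {1, 2, 3, 4, 5, 6}" for v i
      using that z10[OF that]
      by (auto simp: ext sum_9 E12(1-6) E16(1-6) z1 z1' z2 z3 z4 z5 z6 z7 z8 z9)
    show "\<delta> v $ i = D i i * v $ i" if v: "\<forall>j\<in>{1, 2, 3, 4, 5, 6}. v $ j = 0" for v i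
    proof -
      have "\<forall>i. \<delta> v $ i = D i i * v $ i"
        unfolding all_9 using v z10
        by (simp add: ext sum_9 E12(1-6) E16(1-6) z4 z5 z6 z7 z8 z9)
      then show ?thesis by blast
    qed
  qed (use E12(7) E14(9) E16(8) E2(3,8) E3(6) E4(1) t0 in simp_all)
qed

text \<open>Were the filtration of the algebra by \<open>P = \<langle>e\<^sub>3, \<dots>, e\<^sub>9\<rangle>\<close> and \<open>\<langle>e\<^sub>7\<rangle>\<close> a grading with eigenvalues
  0, 1, 2, the degree 0 part would be spanned by two commuting vectors \<open>y1, y2\<close>, and a functional \<open>\<xi>\<close>
  vanishing in degrees 0 and 1 would kill their brackets with \<open>P\<close>. The latter condition determines the
  coordinates 3 to 6 of \<open>y1\<close> and \<open>y2\<close> from \<open>\<xi>\<close>; the \<open>e\<^sub>8\<close>-component of \<open>[y1, y2] = 0\<close> makes \<open>\<xi>\<close> vanish on \<open>e\<^sub>9\<close>, and then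
  the \<open>e\<^sub>7\<close>-component of \<open>[y1, y2]\<close> is 1.\<close>

lemma no_graded_complement:
  fixes y1 y2 :: "real ^ 9" and \<xi> :: "real ^ 9 \<Rightarrow> real"
  assumes t: "0 < t"
    and y: "y1 $ 1 = 1" "y1 $ 2 = 0" "y2 $ 1 = 0" "y2 $ 2 = 1" "mu t y1 y2 = 0"
    and \<xi>: "linear \<xi>" "\<xi> (bv 7) \<noteq> 0"
    and orth: "\<And>i. i \<in> {3, 4, 5, 6} \<Longrightarrow> \<xi> (mu t y1 (bv i)) = 0"
      "\<And>i. i \<in> {3, 4, 5, 6} \<Longrightarrow> \<xi> (mu t y2 (bv i)) = 0"
  shows False
proof -
  define \<alpha> \<beta> \<gamma> where abc: "\<alpha> = \<xi> (bv 7)" "\<beta> = \<xi> (bv 8)" "\<gamma> = \<xi> (bv 9)"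
  have ext: "\<xi> (mu t x z) = mu t x z $ 7 * \<alpha> + mu t x z $ 8 * \<beta> + mu t x z $ 9 * \<gamma>" for x z
    unfolding abc by (subst linear_9[OF \<xi>(1)]) (simp add: sum_9 mu_nth(1-6))
  note simps = ext mu_nth minor2_def bv_nth y
  have 1: "\<beta> + t * (y1 $ 3 * \<alpha>) = 0" "t * \<gamma> + y1 $ 5 * \<alpha> = 0"
    using orth(1)[of 6] orth(1)[of 4] by (simp_all add: simps algebra_simps)
  have 2: "\<gamma> + t * (y2 $ 6 * \<alpha>) = 0" "t * \<beta> + y2 $ 4 * \<alpha> = 0" "y2 $ 3 = 0" "y2 $ 5 = 0"
    using orth(2)[of 3] orth(2)[of 5] orth(2)[of 6] orth(2)[of 4] t \<xi>(2)
    by (simp_all add: simps algebra_simps abc(1)[symmetric])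
  have c: "y2 $ 6 + t * y1 $ 5 = 0"
    using arg_cong[OF y(5), of "\<lambda>v. v $ 8"] y(1-4) by (simp add: mu_nth minor2_def)
  have d: "y1 $ 5 * y2 $ 4 + t * (y1 $ 3 * y2 $ 6) + 1 = 0"
    using arg_cong[OF y(5), of "\<lambda>v. v $ 7"] y(1-4) 2(3,4)
    by (simp add: mu_nth minor2_def algebra_simps)
  have "(1 + t * (t * t)) * \<gamma> = \<gamma> + t * (y2 $ 6 * \<alpha>) + t * t * (t * \<gamma> + y1 $ 5 * \<alpha>) - t * \<alpha> * (y2 $ 6 + t * y1 $ 5)"
    by (simp add: algebra_simps)
  then have "\<gamma> = 0"
    using 1 2 c t by (simp add: add_pos_pos less_imp_neq[symmetric])
  then have "y1 $ 5 = 0" "y2 $ 6 = 0"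
    using 1(2) 2(1) t \<xi>(2) by (simp_all add: abc(1)[symmetric])
  then show False using d by simp
qed

section \<open>Solvable Lie algebras and their nilradicals\<close>

lemma lie_bracketD:
  assumes "is_lie_bracket br"
  shows "bilinear br" "br x x = 0" "br y x = - br x y"
    "br (br x y) z = br x (br y z) - br y (br x z)"
proof -
  show bil: "bilinear br" and alt: "br x x = 0" for x
    using assms by (auto simp: is_lie_bracket_def)
  show skew: "br y x = - br x y" for x y
  proof -
    have "br (x + y) (x + y) = br x x + br x y + (br y x + br y y)"
      by (simp add: bilinear_ladd[OF bil] bilinear_radd[OF bil])
    then show ?thesis by (simp add: alt eq_neg_iff_add_eq_0 add.commute)
  qed
  have "br x (br y z) + br y (br z x) + br z (br x y) = 0"
    using assms by (auto simp: is_lie_bracket_def)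
  moreover have "br y (br z x) = - br y (br x z)"
    using skew[of z x] bilinear_rneg[OF bil] by simp
  moreover have "br z (br x y) = - br (br x y) z"
    by (rule skew)
  ultimately show "br (br x y) z = br x (br y z) - br y (br x z)"
    by (simp add: algebra_simps)
qed

lemma lie_product_subset:
  "subspace S \<Longrightarrow> (\<And>x y. x \<in> A \<Longrightarrow> y \<in> B \<Longrightarrow> br x y \<in> S) \<Longrightarrow> lie_product br A B \<subseteq> S"
  unfolding lie_product_def by (rule span_minimal) auto

lemma lie_product_eq_0:
  "(\<And>x y. x \<in> A \<Longrightarrow> y \<in> B \<Longrightarrow> br x y = 0) \<Longrightarrow> lie_product br A B = {0}"
  using lie_product_subset[of "{0}" A B br] span_zero[of "{br x y |x y. x \<in> A \<and> y \<in> B}"]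
  unfolding lie_product_def by (auto simp: subspace_single_0)

lemma lie_product_base: "x \<in> A \<Longrightarrow> y \<in> B \<Longrightarrow> br x y \<in> lie_product br A B"
  unfolding lie_product_def by (rule span_base) auto

lemma lie_ideal_lie_product:
  assumes br: "is_lie_bracket br" and A: "lie_ideal br A" and B: "lie_ideal br B"
  shows "lie_ideal br (lie_product br A B)"
proof -
  note bil = lie_bracketD(1)[OF br]
  have sub: "subspace (lie_product br A B)"
    unfolding lie_product_def by (rule subspace_span)
  have "br z y \<in> lie_product br A B" if "y \<in> lie_product br A B" for z y
  proof -
    have "subspace {y. br z y \<in> lie_product br A B}"
      using sub by (auto simp: subspace_def bilinear_rzero[OF bil] bilinear_radd[OF bil] bilinear_rmul[OF bil])
    moreover have "br z (br a b) \<in> lie_product br A B" if "a \<in> A" "b \<in> B" for a b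
    proof -
      have "br z (br a b) = br (br z a) b + br a (br z b)"
        using lie_bracketD(4)[OF br, of z a b] by simp
      moreover have "br z a \<in> A" "br z b \<in> B"
        using A B that by (auto simp: lie_ideal_def)
      ultimately show ?thesis
        using that sub by (auto simp: subspace_add lie_product_base)
    qed
    ultimately have "lie_product br A B \<subseteq> {y. br z y \<in> lie_product br A B}"
      by (intro lie_product_subset) auto
    then show ?thesis using that by auto
  qed
  then show ?thesis using sub by (auto simp: lie_ideal_def)
qed

lemma lie_ideal_derived_series:
  assumes "is_lie_bracket br"
  shows "lie_ideal br (derived_series br UNIV k)"
  by (induction k) (auto simp: lie_ideal_lie_product[OF assms] lie_ideal_def[of br UNIV])

text \<open>If the centralizer \<open>C\<close> of \<open>N\<close> were not contained in \<open>N\<close>, the last term of the derived series whose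
  intersection \<open>I\<close> with \<open>C\<close> leaves \<open>N\<close> would satisfy \<open>[I, I] \<subseteq> N\<close> and \<open>[I, [I, I]] = 0\<close>. Then \<open>I\<close> is a
  nilpotent ideal, contradicting the maximality of \<open>N\<close>.\<close>

lemma centralizer_of_nilradical:
  assumes br: "is_lie_bracket br" and sol: "lie_solvable br UNIV" and nil: "is_nilradical br N"
    and x: "\<forall>n\<in>N. br x n = 0"
  shows "x \<in> N"
proof -
  note bil = lie_bracketD(1)[OF br]
  define C where "C = {x. \<forall>n\<in>N. br x n = 0}"
  define D where "D = derived_series br UNIV"
  have N: "lie_ideal br N" and max: "\<And>I. lie_ideal br I \<Longrightarrow> lie_nilpotent br I \<Longrightarrow> I \<subseteq> N"
    using nil by (auto simp: is_nilradical_def)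
  have C: "lie_ideal br C"
  proof -
    have "subspace C"
      by (auto simp: C_def subspace_def bilinear_lzero[OF bil] bilinear_ladd[OF bil] bilinear_lmul[OF bil])
    moreover have "br z y \<in> C" if "y \<in> C" for z y
      using that N by (auto simp: C_def lie_bracketD(4)[OF br] bilinear_rzero[OF bil] lie_ideal_def)
    ultimately show ?thesis by (auto simp: lie_ideal_def)
  qed
  have "\<exists>k. C \<inter> D k \<subseteq> N"
    using sol N by (force simp: lie_solvable_def D_def lie_ideal_def subspace_0)
  then obtain k where k: "C \<inter> D k \<subseteq> N" and least: "\<And>j. j < k \<Longrightarrow> \<not> C \<inter> D j \<subseteq> N"
    by (metis (no_types, lifting) exists_least_iff[of "\<lambda>k. C \<inter> D k \<subseteq> N"])
  have "k = 0"
  proof (cases k)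
    case (Suc j)
    define I where "I = C \<inter> D j"
    have I: "lie_ideal br I"
      using C lie_ideal_derived_series[OF br, of j]
      by (auto simp: I_def D_def lie_ideal_def intro: subspace_inter)
    have "lie_product br I I \<subseteq> C \<inter> D (Suc j)"
    proof (rule lie_product_subset)
      show "subspace (C \<inter> D (Suc j))"
        using C lie_ideal_derived_series[OF br, of "Suc j"]
        by (auto simp: D_def lie_ideal_def simp del: derived_series.simps intro: subspace_inter)
      show "br x y \<in> C \<inter> D (Suc j)" if "x \<in> I" "y \<in> I" for x y
        using that C by (auto simp: I_def D_def lie_ideal_def lie_product_base)
    qed
    then have "lie_product br I I \<subseteq> N" using k Suc by blast
    then have "lower_central_series br I (Suc (Suc 0)) = {0}"
      by (simp, intro lie_product_eq_0) (auto simp: I_def C_def)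
    then have "I \<subseteq> N" using max[OF I] unfolding lie_nilpotent_def by blast
    then show ?thesis using least[of j] Suc by (simp add: I_def)
  qed simp
  then show ?thesis using k x by (auto simp: C_def D_def)
qed

lemma solvable_derived_proper:
  fixes br :: "'a::euclidean_space \<Rightarrow> 'a \<Rightarrow> 'a"
  assumes "lie_solvable br UNIV"
  shows "lie_product br UNIV UNIV \<noteq> UNIV"
proof
  assume perfect: "lie_product br UNIV UNIV = UNIV"
  have "derived_series br UNIV k = UNIV" for k
    by (induction k) (simp_all add: perfect)
  then have "(UNIV :: 'a set) = {0}"
    using assms unfolding lie_solvable_def by metis
  then show False
    by (metis nonempty_Basis nonzero_Basis UNIV_I ex_in_conv singletonD)
qed

section \<open>Solvable algebras whose nilradical belongs to the family\<close>

text \<open>The order in which \<open>e\<^sub>1, \<dots>, e\<^sub>9\<close> build up a flag of subspaces that all derivations preserve. Its first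
  1, 3, 7 and 9 vectors span \<open>L\<close>, the centre, \<open>P\<close> and the whole algebra.\<close>

definition flag_index :: "nat \<Rightarrow> 9" where
  "flag_index m = [7, 8, 9, 3, 4, 5, 6, 1, 2] ! m"

lemma less_9_cases: "(\<forall>m<9::nat. P m) \<longleftrightarrow> P 0 \<and> P 1 \<and> P 2 \<and> P 3 \<and> P 4 \<and> P 5 \<and> P 6 \<and> P 7 \<and> P 8"
proof -
  have "{..<9::nat} = {0, 1, 2, 3, 4, 5, 6, 7, 8}"
    by (simp add: lessThan_nat_numeral lessThan_Suc insert_commute)
  then have "(\<forall>m<9::nat. P m) \<longleftrightarrow> (\<forall>m\<in>{0, 1, 2, 3, 4, 5, 6, 7, 8}. P m)"
    by (metis lessThan_iff)
  then show ?thesis by simp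
qed

lemma flag_index_simps:
  "flag_index 0 = 7" "flag_index 1 = 8" "flag_index (Suc 0) = 8" "flag_index 2 = 9" "flag_index 3 = 3" "flag_index 4 = 4"
  "flag_index 5 = 5" "flag_index 6 = 6" "flag_index 7 = 1" "flag_index 8 = 2"
  by (simp_all add: flag_index_def)

locale nilradical_mu =
  fixes t :: real and br :: "'s::euclidean_space \<Rightarrow> 's \<Rightarrow> 's" and \<phi> :: "real ^ 9 \<Rightarrow> 's"
  assumes t: "1 < t" and lie: "is_lie_bracket br" and solvable: "lie_solvable br UNIV"
    and lin: "linear \<phi>" and inj: "inj \<phi>" and hom: "\<phi> (mu t x y) = br (\<phi> x) (\<phi> y)"
    and nilradical: "is_nilradical br (range \<phi>)"
begin

lemmas bil = lie_bracketD(1)[OF lie]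
lemmas alt = lie_bracketD(2)[OF lie]
lemmas skew = lie_bracketD(3)[OF lie]
lemmas jacobi = lie_bracketD(4)[OF lie]

lemma br_ideal: "br x (\<phi> v) \<in> range \<phi>"
  using nilradical by (auto simp: is_nilradical_def lie_ideal_def)

definition flag :: "nat \<Rightarrow> 's set" where
  "flag k = \<phi> ` {v. \<forall>m<9. k \<le> m \<longrightarrow> v $ flag_index m = 0}"

lemma in_flag: "\<phi> v \<in> flag k \<longleftrightarrow> (\<forall>m<9. k \<le> m \<longrightarrow> v $ flag_index m = 0)"
  using inj by (auto simp: flag_def inj_def)

lemma flag_range: "x \<in> flag k \<Longrightarrow> x \<in> range \<phi>"
  by (auto simp: flag_def)

lemma flag_9: "flag 9 = range \<phi>"
  by (auto simp: flag_def)

lemma flag_mono: "k \<le> l \<Longrightarrow> flag k \<subseteq> flag l"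
  unfolding flag_def by (rule image_mono) auto

lemma subspace_flag: "subspace (flag k)"
  unfolding flag_def
  by (rule linear_subspace_image[OF lin]) (auto simp: subspace_def)

text \<open>The conclusion of \<open>derivation_mu\<close> for the derivation induced by \<open>x\<close>. The implications over \<open>w\<close>
  avoid an explicit inverse of \<open>\<phi>\<close>.\<close>

definition acts_diagonally :: "'s \<Rightarrow> (9 \<Rightarrow> real) \<Rightarrow> bool" where
  "acts_diagonally x d \<longleftrightarrow>
    (\<forall>v w. br x (\<phi> v) = \<phi> w \<longrightarrow> (\<forall>i\<in>{1, 2, 3, 4, 5, 6}. w $ i = d i * v $ i)) \<and>
    (\<forall>v w. br x (\<phi> v) = \<phi> w \<longrightarrow> (\<forall>j\<in>{1, 2, 3, 4, 5, 6}. v $ j = 0) \<longrightarrow> (\<forall>i. w $ i = d i * v $ i)) \<and>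
    d 7 = d 1 + d 2 \<and> d 7 = d 3 + d 6 \<and> d 7 = d 4 + d 5 \<and>
    d 8 = d 1 + d 6 \<and> d 8 = d 2 + d 5 \<and> d 9 = d 1 + d 4 \<and> d 9 = d 2 + d 3"

definition weights :: "'s \<Rightarrow> 9 \<Rightarrow> real" where
  "weights x = (SOME d. acts_diagonally x d)"

lemma weights:
  "br x (\<phi> v) = \<phi> w \<Longrightarrow> i \<in> {1, 2, 3, 4, 5, 6} \<Longrightarrow> w $ i = weights x i * v $ i"
  "br x (\<phi> v) = \<phi> w \<Longrightarrow> (\<forall>j\<in>{1, 2, 3, 4, 5, 6}. v $ j = 0) \<Longrightarrow> w $ i = weights x i * v $ i"
  and weights_eq:
  "weights x 7 = weights x 1 + weights x 2" "weights x 7 = weights x 3 + weights x 6"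
  "weights x 7 = weights x 4 + weights x 5" "weights x 8 = weights x 1 + weights x 6"
  "weights x 8 = weights x 2 + weights x 5" "weights x 9 = weights x 1 + weights x 4"
  "weights x 9 = weights x 2 + weights x 3"
proof -
  define \<delta> where "\<delta> v = inv \<phi> (br x (\<phi> v))" for v
  have \<delta>: "\<phi> (\<delta> v) = br x (\<phi> v)" for v
    unfolding \<delta>_def using br_ideal by (rule f_inv_into_f)
  have inj': "a = b" if "\<phi> a = \<phi> b" for a b
    using inj that by (rule injD)
  have lin_\<delta>: "linear \<delta>"
    by (rule linearI; rule inj')
       (simp_all add: \<delta> linear_add[OF lin] linear_cmul[OF lin] bilinear_radd[OF bil] bilinear_rmul[OF bil])
  have der: "\<delta> (mu t a b) = mu t (\<delta> a) b + mu t a (\<delta> b)" for a b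
    by (rule inj') (simp add: \<delta> hom linear_add[OF lin] jacobi)
  from derivation_mu[OF t lin_\<delta> der] obtain d where d:
    "\<And>v i. i \<in> {1, 2, 3, 4, 5, 6} \<Longrightarrow> \<delta> v $ i = d i * v $ i"
    "\<And>v i. \<forall>j\<in>{1, 2, 3, 4, 5, 6}. v $ j = 0 \<Longrightarrow> \<delta> v $ i = d i * v $ i"
    "d 7 = d 1 + d 2" "d 7 = d 3 + d 6" "d 7 = d 4 + d 5"
    "d 8 = d 1 + d 6" "d 8 = d 2 + d 5" "d 9 = d 1 + d 4" "d 9 = d 2 + d 3"
    by blast
  have w: "w = \<delta> v" if "br x (\<phi> v) = \<phi> w" for v w
    by (rule inj') (simp add: \<delta> that)
  have "acts_diagonally x d"
    unfolding acts_diagonally_def using d(3-)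
  proof (intro conjI allI impI ballI)
    show "w $ i = d i * v $ i" if "br x (\<phi> v) = \<phi> w" "i \<in> {1, 2, 3, 4, 5, 6}" for v w i
      using d(1) w that by blast
    show "w $ i = d i * v $ i" if "br x (\<phi> v) = \<phi> w" "\<forall>j\<in>{1, 2, 3, 4, 5, 6}. v $ j = 0" for v w i
      unfolding w[OF that(1)] by (rule d(2)[OF that(2)])
  qed simp_all
  then have P: "acts_diagonally x (weights x)"
    unfolding weights_def by (rule someI[of "acts_diagonally x"])
  show "w $ i = weights x i * v $ i"
    if "br x (\<phi> v) = \<phi> w" "i \<in> {1, 2, 3, 4, 5, 6}"
    using P that unfolding acts_diagonally_def by blast
  show "w $ i = weights x i * v $ i"
    if "br x (\<phi> v) = \<phi> w" "\<forall>j\<in>{1, 2, 3, 4, 5, 6}. v $ j = 0"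
    using P that unfolding acts_diagonally_def by blast
  show
    "weights x 7 = weights x 1 + weights x 2" "weights x 7 = weights x 3 + weights x 6"
    "weights x 7 = weights x 4 + weights x 5" "weights x 8 = weights x 1 + weights x 6"
    "weights x 8 = weights x 2 + weights x 5" "weights x 9 = weights x 1 + weights x 4"
    "weights x 9 = weights x 2 + weights x 3"
    using P unfolding acts_diagonally_def by blast+
qed

lemma in_flag_3: "\<phi> v \<in> flag 3 \<longleftrightarrow> (\<forall>j\<in>{1, 2, 3, 4, 5, 6}. v $ j = 0)"
  unfolding in_flag less_9_cases by (auto simp: flag_index_simps)

lemma in_flag_7: "\<phi> v \<in> flag 7 \<longleftrightarrow> v $ 1 = 0 \<and> v $ 2 = 0"
  unfolding in_flag less_9_cases by (simp add: flag_index_simps)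

lemma in_flag_1: "\<phi> v \<in> flag 1 \<longleftrightarrow> (\<forall>j\<in>{1, 2, 3, 4, 5, 6, 8, 9}. v $ j = 0)"
  unfolding in_flag less_9_cases by (auto simp: flag_index_simps)

lemma br_coords:
  assumes "\<phi> v \<in> flag (Suc k)" "br x (\<phi> v) = \<phi> w" "k \<le> m" "m < 9"
  shows "w $ flag_index m = weights x (flag_index m) * v $ flag_index m"
proof (cases "m < 3")
  case True
  then have "\<phi> v \<in> flag 3" using assms(1,3) flag_mono[of "Suc k" 3] by auto
  then show ?thesis unfolding in_flag_3 by (rule weights(2)[OF assms(2)])
next
  case False
  have "\<forall>m<9. 3 \<le> m \<longrightarrow> flag_index m \<in> {1, 2, 3, 4, 5, 6}"
    unfolding less_9_cases by (simp add: flag_index_simps)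
  then have "flag_index m \<in> {1, 2, 3, 4, 5, 6}"
    using False assms(4) not_less by blast
  then show ?thesis by (rule weights(1)[OF assms(2)])
qed

lemma br_flag:
  assumes "u \<in> flag k"
  shows "br x u \<in> flag k"
proof (cases k)
  case 0
  obtain v where v: "u = \<phi> v" using flag_range[OF assms] by auto
  then have "v = 0"
    using assms 0 by (simp add: in_flag less_9_cases flag_index_simps vec_eq_iff all_9)
  then have "u = 0" using v by (simp add: linear_0[OF lin])
  then show ?thesis using assms by (simp add: bilinear_rzero[OF bil])
next
  case (Suc l)
  obtain v where v: "u = \<phi> v" using flag_range[OF assms] by auto
  obtain w where w: "br x (\<phi> v) = \<phi> w" using br_ideal by blast
  have "w $ flag_index m = 0" if "k \<le> m" "m < 9" for m
  proof -
    have "v $ flag_index m = 0" using assms that unfolding v in_flag by blast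
    moreover have "\<phi> v \<in> flag (Suc l)" using assms v Suc by simp
    moreover have "l \<le> m" using that Suc by simp
    ultimately show ?thesis using br_coords[OF _ w _ that(2)] by simp
  qed
  then show ?thesis unfolding v w in_flag by blast
qed

lemma br_range_flag_3:
  assumes "x \<in> range \<phi>" "y \<in> range \<phi>"
  shows "br x y \<in> flag 3"
proof -
  obtain v w where vw: "x = \<phi> v" "y = \<phi> w" using assms by auto
  show ?thesis unfolding vw hom[symmetric] in_flag_3 by (simp add: mu_nth)
qed

lemma br_center:
  assumes "x \<in> range \<phi>" "y \<in> flag 3"
  shows "br x y = 0"
proof -
  obtain v w where vw: "x = \<phi> v" "y = \<phi> w" using assms flag_range by blast
  have "\<forall>j\<in>{1, 2, 3, 4, 5, 6}. w $ j = 0" using assms(2) unfolding vw in_flag_3 .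
  then have "mu t v w = 0" by (simp add: mu_def minor2_def)
  then show ?thesis unfolding vw hom[symmetric] by (simp add: linear_0[OF lin])
qed

lemma br_flag_7:
  assumes "x \<in> flag 7" "y \<in> flag 7"
  shows "br x y \<in> flag 1"
proof -
  obtain v w where vw: "x = \<phi> v" "y = \<phi> w" using assms flag_range by blast
  have "v $ 1 = 0" "v $ 2 = 0" "w $ 1 = 0" "w $ 2 = 0"
    using assms unfolding vw in_flag_7 by auto
  then show ?thesis unfolding vw hom[symmetric] in_flag_1 by (simp add: mu_nth minor2_def)
qed

text \<open>Diagonal operators commute, so every bracket \<open>[x, y]\<close> lies in the set \<open>K\<close> of elements that map the nilradical
  into its centre and annihilate the centre. Now \<open>K\<close> is an ideal and \<open>[K, K]\<close> centralizes the nilradical,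
  hence lies in it; so \<open>[K, [K, K]]\<close> lies in its centre and one more bracket with \<open>K\<close> vanishes. Thus
  \<open>K\<close> is nilpotent and contained in the nilradical.\<close>

lemma derived_in_nilradical: "br x y \<in> range \<phi>"
proof -
  define K where "K = {x. \<forall>v. br x (\<phi> v) \<in> flag 3 \<and> (\<phi> v \<in> flag 3 \<longrightarrow> br x (\<phi> v) = 0)}"
  have br_K: "br x y \<in> K" for x y
  proof -
    have "br (br x y) (\<phi> v) \<in> flag 3 \<and> (\<phi> v \<in> flag 3 \<longrightarrow> br (br x y) (\<phi> v) = 0)" for v
    proof -
      obtain w1 w2 w3 w4 where w: "br y (\<phi> v) = \<phi> w1" "br x (\<phi> w1) = \<phi> w2"
        "br x (\<phi> v) = \<phi> w3" "br y (\<phi> w3) = \<phi> w4"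
      proof -
        obtain w1 where 1: "br y (\<phi> v) = \<phi> w1" using br_ideal by blast
        obtain w2 where 2: "br x (\<phi> w1) = \<phi> w2" using br_ideal by blast
        obtain w3 where 3: "br x (\<phi> v) = \<phi> w3" using br_ideal by blast
        obtain w4 where "br y (\<phi> w3) = \<phi> w4" using br_ideal by blast
        with 1 2 3 show thesis by (rule that)
      qed
      have b: "br (br x y) (\<phi> v) = \<phi> (w2 - w4)"
        by (simp add: jacobi w linear_diff[OF lin])
      have "(w2 - w4) $ i = 0" if "i \<in> {1, 2, 3, 4, 5, 6}" for i
        using weights(1)[OF w(1) that] weights(1)[OF w(2) that] weights(1)[OF w(3) that]
          weights(1)[OF w(4) that] by simp
      then have 1: "br (br x y) (\<phi> v) \<in> flag 3" unfolding b in_flag_3 by blast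
      moreover have "br (br x y) (\<phi> v) = 0" if "\<phi> v \<in> flag 3"
      proof -
        have v: "\<forall>j\<in>{1, 2, 3, 4, 5, 6}. v $ j = 0" using that by (simp add: in_flag_3)
        have v1: "\<forall>j\<in>{1, 2, 3, 4, 5, 6}. w1 $ j = 0" "\<forall>j\<in>{1, 2, 3, 4, 5, 6}. w3 $ j = 0"
          using weights(2)[OF w(1) v] weights(2)[OF w(3) v] v by simp_all
        have "w2 = w4"
          using weights(2)[OF w(1) v] weights(2)[OF w(2) v1(1)] weights(2)[OF w(3) v]
            weights(2)[OF w(4) v1(2)] by (simp add: vec_eq_iff)
        then show ?thesis unfolding b by (simp add: linear_0[OF lin])
      qed
      ultimately show ?thesis by blast
    qed
    then show ?thesis unfolding K_def by blast
  qed
  have K1: "br x y \<in> flag 3" if "x \<in> K" "y \<in> range \<phi>" for x y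
    using that by (auto simp: K_def)
  have K2: "br x y = 0" if xy: "x \<in> K" "y \<in> flag 3" for x y
  proof -
    obtain v where "y = \<phi> v" using flag_range[OF xy(2)] by auto
    then show ?thesis using xy by (simp add: K_def)
  qed
  have subK: "subspace K"
    using subspace_flag[of 3]
    by (auto simp: K_def subspace_def bilinear_lzero[OF bil] bilinear_ladd[OF bil] bilinear_lmul[OF bil])
  then have K: "lie_ideal br K"
    using br_K by (simp add: lie_ideal_def)
  have sub: "subspace (range \<phi>)" using subspace_flag[of 9] by (simp add: flag_9)
  have 1: "lie_product br K K \<subseteq> range \<phi>"
  proof (rule lie_product_subset[OF sub])
    fix x y assume "x \<in> K" "y \<in> K"
    have "br (br x y) (\<phi> v) = 0" for v
    proof -
      have "br x (br y (\<phi> v)) = 0" "br y (br x (\<phi> v)) = 0"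
        by (rule K2; (rule K1)?; simp add: \<open>x \<in> K\<close> \<open>y \<in> K\<close>)+
      then show ?thesis by (simp add: jacobi)
    qed
    then show "br x y \<in> range \<phi>"
      by (intro centralizer_of_nilradical[OF lie solvable nilradical]) blast
  qed
  have 2: "lie_product br K (lie_product br K K) \<subseteq> flag 3"
    using 1 by (intro lie_product_subset[OF subspace_flag] K1) auto
  have "lie_product br K (lie_product br K (lie_product br K K)) = {0}"
    using 2 by (intro lie_product_eq_0 K2) auto
  then have "lower_central_series br K (Suc (Suc (Suc 0))) = {0}" by simp
  then have "lie_nilpotent br K" unfolding lie_nilpotent_def by blast
  then have "K \<subseteq> range \<phi>" using K nilradical by (auto simp: is_nilradical_def)
  then show ?thesis using br_K by blast
qed

subsection \<open>An orthonormal basis adapted to the flag\<close>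

lemma flag_unit_vector:
  assumes "k < 9"
  obtains u where "u \<in> flag (Suc k)" "norm u = 1" "\<And>w. w \<in> flag k \<Longrightarrow> u \<bullet> w = 0"
proof -
  let ?e = "\<phi> (bv (flag_index k))"
  have "flag_index m \<noteq> flag_index k" if "m < 9" "m \<noteq> k" for m
  proof -
    have "\<forall>k<9. \<forall>m<9. m \<noteq> k \<longrightarrow> flag_index m \<noteq> flag_index k"
      unfolding less_9_cases by (simp add: flag_index_simps)
    then show ?thesis using that assms by blast
  qed
  then have e: "?e \<in> flag (Suc k)" "?e \<notin> flag k"
    using assms by (auto simp: in_flag bv_nth)
  have span: "span (flag j) = flag j" for j
    by (rule span_subspace[OF order_refl _ subspace_flag]) (rule span_superset)
  have "span (flag k) \<subset> span (flag (Suc k))"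
    unfolding span using e flag_mono[of k "Suc k"] by auto
  then obtain x where x: "x \<noteq> 0" "x \<in> span (flag (Suc k))" "\<And>y. y \<in> span (flag k) \<Longrightarrow> orthogonal x y"
    using orthogonal_to_subspace_exists_gen by blast
  show thesis
  proof (rule that[of "x /\<^sub>R norm x"])
    show "x /\<^sub>R norm x \<in> flag (Suc k)"
      using x(2) subspace_flag unfolding span by (simp add: subspace_scale)
    show "norm (x /\<^sub>R norm x) = 1" using x(1) by simp
    show "(x /\<^sub>R norm x) \<bullet> w = 0" if "w \<in> flag k" for w
      using x(3)[of w] that unfolding span by (simp add: orthogonal_def)
  qed
qed

text \<open>A Gram-Schmidt basis of the nilradical along the flag.\<close>

definition frame :: "nat \<Rightarrow> 's" where
  "frame k = (SOME u. u \<in> flag (Suc k) \<and> norm u = 1 \<and> (\<forall>w\<in>flag k. u \<bullet> w = 0))"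

lemma frame:
  assumes "k < 9"
  shows "frame k \<in> flag (Suc k)" "norm (frame k) = 1" "w \<in> flag k \<Longrightarrow> frame k \<bullet> w = 0"
proof -
  let ?P = "\<lambda>u. u \<in> flag (Suc k) \<and> norm u = 1 \<and> (\<forall>w\<in>flag k. u \<bullet> w = 0)"
  obtain u where "u \<in> flag (Suc k)" "norm u = 1" "\<And>w. w \<in> flag k \<Longrightarrow> u \<bullet> w = 0"
    by (rule flag_unit_vector[OF assms]) blast
  then have "?P u" by blast
  then have "?P (frame k)" unfolding frame_def by (rule someI[of ?P])
  then show "frame k \<in> flag (Suc k)" "norm (frame k) = 1" "w \<in> flag k \<Longrightarrow> frame k \<bullet> w = 0"
    by auto
qed

lemma frame_in_flag: "j < 9 \<Longrightarrow> j < k \<Longrightarrow> frame j \<in> flag k"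
  using frame(1)[of j] flag_mono[of "Suc j" k] by auto

lemma frame_orthogonal_flag: "j < 9 \<Longrightarrow> k \<le> j \<Longrightarrow> w \<in> flag k \<Longrightarrow> frame j \<bullet> w = 0"
  using frame(3)[of j w] flag_mono[of k j] by auto

lemma frame_inner:
  assumes "j < 9" "k < 9"
  shows "frame j \<bullet> frame k = (if j = k then 1 else 0)"
proof -
  consider "j = k" | "j < k" | "k < j" by linarith
  then show ?thesis
  proof cases
    case 1
    then show ?thesis using frame(2)[OF assms(1)] by (simp add: norm_eq_1)
  next
    case 2
    then show ?thesis
      using frame_orthogonal_flag[OF assms(2) order_refl frame_in_flag[OF assms(1) 2]]
      by (simp add: inner_commute)
  next
    case 3
    then show ?thesis
      using frame_orthogonal_flag[OF assms(1) order_refl frame_in_flag[OF assms(2) 3]] by simp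
  qed
qed

lemma inj_on_frame: "inj_on frame {..<9}"
  by (rule inj_onI) (metis frame_inner lessThan_iff zero_neq_one)

text \<open>Modulo the preceding step of the flag, to which \<open>frame k\<close> is orthogonal, \<open>ad x\<close> acts on the
  \<open>k\<close>-th step as a scalar.\<close>

lemma frame_diagonal:
  assumes k: "k < 9"
  shows "br x (frame k) \<bullet> frame k = weights x (flag_index k)"
proof -
  let ?d = "weights x (flag_index k)"
  obtain v where v: "frame k = \<phi> v" using flag_range[OF frame(1)[OF k]] by auto
  obtain w where w: "br x (\<phi> v) = \<phi> w" using br_ideal by blast
  have fv: "\<phi> v \<in> flag (Suc k)" using frame(1)[OF k] v by simp
  have "(w - ?d *\<^sub>R v) $ flag_index m = 0" if "m < 9" "k \<le> m" for m
  proof (cases "m = k")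
    case True
    then show ?thesis using br_coords[OF fv w, of k] k by simp
  next
    case False
    then have "v $ flag_index m = 0" using fv that unfolding in_flag by auto
    then show ?thesis using br_coords[OF fv w that(2,1)] by simp
  qed
  then have "\<phi> (w - ?d *\<^sub>R v) \<in> flag k" unfolding in_flag by blast
  then have "frame k \<bullet> \<phi> (w - ?d *\<^sub>R v) = 0" by (rule frame(3)[OF k])
  then have "frame k \<bullet> (br x (frame k) - ?d *\<^sub>R frame k) = 0"
    by (simp add: v w linear_diff[OF lin] linear_cmul[OF lin])
  then show ?thesis
    using frame_inner[OF k k] by (simp add: inner_diff_right inner_commute)
qed

text \<open>An orthonormal basis of the orthogonal complement of the nilradical.\<close>

definition complement :: "'s set" where
  "complement = (SOME C. C \<subseteq> {y. \<forall>w\<in>range \<phi>. y \<bullet> w = 0} \<and> pairwise orthogonal C \<and>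
     (\<forall>x\<in>C. norm x = 1) \<and> span C = {y. \<forall>w\<in>range \<phi>. y \<bullet> w = 0})"

lemma complement:
  "y \<in> complement \<Longrightarrow> w \<in> range \<phi> \<Longrightarrow> y \<bullet> w = 0"
  "pairwise orthogonal complement" "y \<in> complement \<Longrightarrow> norm y = 1"
  "span complement = {y. \<forall>w\<in>range \<phi>. y \<bullet> w = 0}"
proof -
  have "subspace {y. \<forall>w\<in>range \<phi>. y \<bullet> w = 0}"
    by (auto simp: subspace_def inner_add_left)
  then obtain C where "C \<subseteq> {y. \<forall>w\<in>range \<phi>. y \<bullet> w = 0} \<and> pairwise orthogonal C \<and>
     (\<forall>x\<in>C. norm x = 1) \<and> span C = {y. \<forall>w\<in>range \<phi>. y \<bullet> w = 0}"
    by (rule orthonormal_basis_subspace) blast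
  then have C: "complement \<subseteq> {y. \<forall>w\<in>range \<phi>. y \<bullet> w = 0} \<and> pairwise orthogonal complement \<and>
     (\<forall>x\<in>complement. norm x = 1) \<and> span complement = {y. \<forall>w\<in>range \<phi>. y \<bullet> w = 0}"
    unfolding complement_def by (rule someI)
  show "y \<in> complement \<Longrightarrow> w \<in> range \<phi> \<Longrightarrow> y \<bullet> w = 0"
    "pairwise orthogonal complement" "y \<in> complement \<Longrightarrow> norm y = 1"
    "span complement = {y. \<forall>w\<in>range \<phi>. y \<bullet> w = 0}"
    using C by (blast, simp_all)
qed

definition adapted_basis :: "'s set" where
  "adapted_basis = frame ` {..<9} \<union> complement"

lemma frame_notin_complement: "k < 9 \<Longrightarrow> frame k \<notin> complement"
  using complement(1)[of "frame k" "frame k"] frame_inner[of k k] flag_range[OF frame(1)[of k]]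
  by (metis zero_neq_one)

lemma orthonormal_adapted_basis: "orthonormal_basis adapted_basis"
proof -
  have "pairwise orthogonal (frame ` {..<9})"
    using frame_inner by (auto simp: pairwise_def orthogonal_def)
  then have pw: "pairwise orthogonal adapted_basis"
    using complement(1,2) flag_range[OF frame(1)]
    by (auto simp: adapted_basis_def pairwise_def orthogonal_def inner_commute)
  have norm: "\<forall>b\<in>adapted_basis. norm b = 1"
    using frame(2) complement(3) by (auto simp: adapted_basis_def)
  have "independent (frame ` {..<9})"
  proof (rule pairwise_orthogonal_independent)
    show "pairwise orthogonal (frame ` {..<9})" by fact
    show "0 \<notin> frame ` {..<9}" using frame(2) by fastforce
  qed
  moreover have sub: "frame ` {..<9} \<subseteq> range \<phi>"
    using flag_range[OF frame(1)] by blast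
  moreover have "dim (range \<phi>) \<le> card (frame ` {..<9})"
  proof -
    have "dim (range \<phi>) = DIM(real ^ 9)"
      using dim_image_eq[OF lin, of UNIV] inj by (simp add: dim_UNIV)
    then show ?thesis using card_image[OF inj_on_frame] by simp
  qed
  ultimately have range: "range \<phi> \<subseteq> span (frame ` {..<9})"
    by (intro card_ge_dim_independent) auto
  have "v \<in> span adapted_basis" for v
  proof -
    obtain y z where yz: "y \<in> span (range \<phi>)" "\<And>w. w \<in> span (range \<phi>) \<Longrightarrow> orthogonal z w" "v = y + z"
      using orthogonal_subspace_decomp_exists[of "range \<phi>" v] by blast
    have "y \<in> span (frame ` {..<9})"
      using yz(1) range by (metis span_minimal subspace_span subsetD)
    moreover have "z \<in> span complement"
      unfolding complement(4) using yz(2)[OF span_base] by (simp add: orthogonal_def)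
    moreover have "span (frame ` {..<9}) \<subseteq> span adapted_basis" "span complement \<subseteq> span adapted_basis"
      unfolding adapted_basis_def by (intro span_mono; blast)+
    ultimately show ?thesis
      unfolding yz(3) by (intro span_add) blast+
  qed
  then show ?thesis using pw norm by (auto simp: orthonormal_basis_def)
qed

lemma finite_complement: "finite complement"
  using orthonormal_basis_finite[OF orthonormal_adapted_basis] by (simp add: adapted_basis_def)

lemma sum_adapted_basis:
  "sum g adapted_basis = (\<Sum>k<9. g (frame k)) + sum g complement" for g :: "'s \<Rightarrow> real"
  unfolding adapted_basis_def
proof -
  have "frame ` {..<9} \<inter> complement = {}" using frame_notin_complement by blast
  then show "sum g (frame ` {..<9} \<union> complement) = (\<Sum>k<9. g (frame k)) + sum g complement"
    by (simp add: sum.union_disjoint finite_complement sum.reindex[OF inj_on_frame])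
qed

lemma adapted_basis_flag:
  assumes "b \<in> adapted_basis" "k \<le> 9" "b \<notin> flag k" "w \<in> flag k"
  shows "w \<bullet> b = 0"
proof -
  have "b \<bullet> w = 0"
  proof (cases "b \<in> complement")
    case True
    then show ?thesis using complement(1) flag_range[OF assms(4)] by blast
  next
    case False
    then obtain j where j: "j < 9" "b = frame j" using assms(1) by (auto simp: adapted_basis_def)
    then have "k \<le> j" using frame_in_flag[of j k] assms(3) not_le by blast
    then show ?thesis using frame_orthogonal_flag[OF j(1) _ assms(4)] j(2) by simp
  qed
  then show ?thesis by (simp add: inner_commute)
qed

lemma complement_not_in_flag: "b \<in> complement \<Longrightarrow> b \<notin> flag k"
  using complement(1)[of b b] complement(3)[of b] flag_range[of b k] by (metis norm_eq_1 zero_neq_one)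

lemma frame_in_flag_iff: "j < 9 \<Longrightarrow> frame j \<in> flag k \<longleftrightarrow> j < k"
  using frame_in_flag[of j k] frame_orthogonal_flag[of j k "frame j"] frame_inner[of j j]
  by (metis not_less zero_neq_one)

subsection \<open>The filtration and the Einstein equation\<close>

text \<open>The eigenvalue of \<open>F\<close> on a vector of the adapted basis.\<close>

definition grade :: "'s \<Rightarrow> real" where
  "grade b = of_bool (b \<in> flag 1) + of_bool (b \<in> flag 7)"

lemma sum_9_lessThan: "(\<Sum>k<9. g k) = g 0 + g 1 + g 2 + g 3 + g 4 + g 5 + g 6 + g 7 + g (8::nat)" for g :: "nat \<Rightarrow> real"
  by (simp add: eval_nat_numeral)

lemma sum_grade:
  "(\<Sum>b\<in>adapted_basis. grade b * g b) =
    2 * g (frame 0) + g (frame 1) + g (frame 2) + g (frame 3) + g (frame 4) + g (frame 5) + g (frame 6)"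
  unfolding sum_adapted_basis sum_9_lessThan
  by (simp add: grade_def complement_not_in_flag frame_in_flag_iff)

abbreviation mcv :: 's where "mcv \<equiv> mean_curvature br"

text \<open>The operator \<open>ad x\<close> of an element of the nilradical shifts the filtration of the algebra by the nilradical and its
  centre, so its diagonal vanishes in the adapted basis. In particular \<open>tr (ad x) = 0\<close>.\<close>

lemma ad_nilradical_diagonal: "x \<in> range \<phi> \<Longrightarrow> b \<in> adapted_basis \<Longrightarrow> br x b \<bullet> b = 0"
proof -
  assume x: "x \<in> range \<phi>" and b: "b \<in> adapted_basis"
  consider "b \<in> flag 3" | "b \<notin> flag 3" "b \<in> flag 9" | "b \<notin> flag 9" by blast
  then show "br x b \<bullet> b = 0"
  proof cases
    case 1
    then show ?thesis using br_center[OF x] by simp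
  next
    case 2
    then show ?thesis
      using adapted_basis_flag[OF b _ 2(1)] br_range_flag_3[OF x] by (simp add: flag_9)
  next
    case 3
    then show ?thesis
      using adapted_basis_flag[OF b _ 3] derived_in_nilradical[of x b] by (simp add: flag_9)
  qed
qed

lemma mcv_orthogonal: "mcv \<bullet> br x y = 0"
  unfolding mean_curvature_inner[OF bil orthonormal_adapted_basis]
  by (rule sum.neutral) (use ad_nilradical_diagonal[OF derived_in_nilradical] in blast)

lemma mcv_norm: "mcv \<bullet> mcv = (\<Sum>k<9. weights mcv (flag_index k))"
proof -
  have "(\<Sum>b\<in>complement. br mcv b \<bullet> b) = 0"
    by (rule sum.neutral) (use complement(1) derived_in_nilradical in \<open>simp add: inner_commute\<close>)
  then show ?thesis
    unfolding mean_curvature_inner[OF bil orthonormal_adapted_basis] sum_adapted_basis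
    by (simp add: frame_diagonal)
qed

text \<open>The relations between the weights give \<open>tr (\<delta>|P) + tr (\<delta>|L) = tr \<delta>\<close> for every derivation \<open>\<delta>\<close>,
  because the weights of \<open>e\<^sub>1\<close> and \<open>e\<^sub>2\<close> add up to that of \<open>e\<^sub>7 = [e\<^sub>1, e\<^sub>2]\<close>.\<close>

lemma sum_grade_mcv: "(\<Sum>b\<in>adapted_basis. grade b * (br mcv b \<bullet> b)) = mcv \<bullet> mcv"
  unfolding sum_grade mcv_norm sum_9_lessThan
  using weights_eq[of mcv] by (simp add: frame_diagonal flag_index_simps)

text \<open>The sum is the trace of \<open>(ad a)\<^sup>2\<close>, an operator with values in the centre of the nilradical, which \<open>ad a\<close>
  annihilates.\<close>

lemma killing_zero:
  assumes a: "a \<in> range \<phi>"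
  shows "(\<Sum>b\<in>adapted_basis. \<Sum>c\<in>adapted_basis. (br a b \<bullet> c) * (br a c \<bullet> b)) = 0"
proof -
  have "(\<Sum>c\<in>adapted_basis. (br a b \<bullet> c) * (br a c \<bullet> b)) = br a (br a b) \<bullet> b" for b
  proof -
    have l: "linear (br a)" using bil by (simp add: bilinear_def)
    have "br a (br a b) = br a (\<Sum>c\<in>adapted_basis. (br a b \<bullet> c) *\<^sub>R c)"
      using orthonormal_basis_expand[OF orthonormal_adapted_basis, of "br a b"] by simp
    also have "\<dots> = (\<Sum>c\<in>adapted_basis. (br a b \<bullet> c) *\<^sub>R br a c)"
      by (simp add: linear_sum[OF l] linear_cmul[OF l])
    finally show ?thesis by (simp add: inner_sum_left)
  qed
  moreover have "br a (br a b) \<bullet> b = 0" if b: "b \<in> adapted_basis" for b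
  proof (cases "b \<in> flag 3")
    case True
    then show ?thesis using br_center[OF a] by (simp add: bilinear_rzero[OF bil])
  next
    case False
    then show ?thesis
      using adapted_basis_flag[OF b _ False] br_range_flag_3[OF a derived_in_nilradical] by simp
  qed
  ultimately show ?thesis by simp
qed

text \<open>This is the filtration property \<open>[S\<^sub>i, S\<^sub>j] \<subseteq> S\<^bsub>i+j\<^esub>\<close> for \<open>S\<^sub>0 \<supseteq> S\<^sub>1 = P \<supseteq> S\<^sub>2 = L\<close>, read off in a basis each of
  whose vectors lies in a given step of the filtration or is orthogonal to it.\<close>

lemma grade_superadditive:
  assumes a: "a \<in> adapted_basis" and b: "b \<in> adapted_basis" and c: "c \<in> adapted_basis"
    and nz: "br a b \<bullet> c \<noteq> 0"
  shows "grade a + grade b \<le> grade c"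
proof -
  have mem: "c \<in> flag k" if "br a b \<in> flag k" "k \<le> 9" for k
    using adapted_basis_flag[OF c that(2)] that(1) nz by blast
  have f17: "x \<in> flag 7" if "x \<in> flag 1" for x using that flag_mono[of 1 7] by auto
  have swap: "br a b \<in> flag k" if "a \<in> flag k" for k
    using br_flag[OF that, of b] skew[of a b] subspace_flag[of k] by (metis subspace_neg)
  have center: "br x y = 0" if "x \<in> flag 7" "y \<in> flag 1" for x y
    using br_center[of x y] that flag_range flag_mono[of 1 3] by auto
  have not1: "\<not> (a \<in> flag 7 \<and> b \<in> flag 1)" "\<not> (b \<in> flag 7 \<and> a \<in> flag 1)"
    using center[of a b] center[of b a] nz skew[of a b] by auto
  have 1: "c \<in> flag 1" if "a \<in> flag 7" "b \<in> flag 7"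
    using mem[OF br_flag_7[OF that]] by simp
  have 2: "c \<in> flag k" if "a \<in> flag k \<or> b \<in> flag k" "k \<le> 9" for k
    using that mem[of k] swap[of k] br_flag[of b k a] by blast
  show ?thesis
    using not1 1 2[of 1] 2[of 7] f17[of a] f17[of b] f17[of c] by (auto simp: grade_def)
qed

text \<open>The contribution of one structure constant to \<open>Q\<close>; it vanishes if the constant respects the
  grading by \<open>grade\<close>.\<close>

abbreviation defect :: "'s \<Rightarrow> 's \<Rightarrow> 's \<Rightarrow> real" where
  "defect a b c \<equiv> (grade c - grade a - grade b) * (br a b \<bullet> c)\<^sup>2"

lemma defect_nonneg:
  assumes "a \<in> adapted_basis" "b \<in> adapted_basis" "c \<in> adapted_basis"
  shows "0 \<le> defect a b c"
proof (cases "br a b \<bullet> c = 0")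
  case False
  then show ?thesis using grade_superadditive[OF assms] by simp
qed simp

text \<open>The trace of the Ricci operator against \<open>F\<close>. The quadratic terms of the Ricci form collect, after renaming indices
  and using skew-symmetry, to a multiple of the derivative of the squared norm of the bracket in the direction of \<open>F\<close>, which is
  diagonal in the structure constants. The Killing form contributes nothing: it vanishes on the nilradical, and
  \<open>F\<close> vanishes on its orthogonal complement.\<close>

lemma sum_grade_ricci:
  "(\<Sum>a\<in>adapted_basis. grade a * ricci_form br a a) =
    (\<Sum>a\<in>adapted_basis. \<Sum>b\<in>adapted_basis. \<Sum>c\<in>adapted_basis. defect a b c) / 4 - mcv \<bullet> mcv"
proof -
  let ?B = adapted_basis
  let ?p = "\<lambda>a b c. (br a b \<bullet> c)\<^sup>2"
  have ric: "grade a * ricci_form br a a = (\<Sum>b\<in>?B. \<Sum>c\<in>?B. grade a * ?p b c a) / 4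
      - (\<Sum>b\<in>?B. \<Sum>c\<in>?B. grade a * ?p a b c) / 2 - grade a * (br mcv a \<bullet> a)" for a
  proof (cases "a \<in> range \<phi>")
    case True
    show ?thesis
      unfolding ricci_form_diagonal[OF bil alt orthonormal_adapted_basis] killing_zero[OF True]
      by (simp add: sum_distrib_left algebra_simps)
  next
    case False
    then have "grade a = 0" using flag_range by (auto simp: grade_def)
    then show ?thesis by simp
  qed
  have S1: "(\<Sum>a\<in>?B. \<Sum>b\<in>?B. \<Sum>c\<in>?B. grade a * ?p b c a) = (\<Sum>a\<in>?B. \<Sum>b\<in>?B. \<Sum>c\<in>?B. grade c * ?p a b c)"
  proof -
    have "(\<Sum>a\<in>?B. \<Sum>b\<in>?B. \<Sum>c\<in>?B. grade a * ?p b c a) = (\<Sum>b\<in>?B. \<Sum>a\<in>?B. \<Sum>c\<in>?B. grade a * ?p b c a)"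
      by (rule sum.swap)
    also have "\<dots> = (\<Sum>b\<in>?B. \<Sum>c\<in>?B. \<Sum>a\<in>?B. grade a * ?p b c a)"
      by (rule sum.cong[OF refl]) (rule sum.swap)
    finally show ?thesis .
  qed
  have S2: "(\<Sum>a\<in>?B. \<Sum>b\<in>?B. \<Sum>c\<in>?B. grade a * ?p a b c) = (\<Sum>a\<in>?B. \<Sum>b\<in>?B. \<Sum>c\<in>?B. grade b * ?p a b c)"
  proof -
    have "?p a b c = ?p b a c" for a b c
      using skew[of a b] by simp
    then have "(\<Sum>a\<in>?B. \<Sum>b\<in>?B. \<Sum>c\<in>?B. grade a * ?p a b c) = (\<Sum>a\<in>?B. \<Sum>b\<in>?B. \<Sum>c\<in>?B. grade a * ?p b a c)"
      by simp
    also have "\<dots> = (\<Sum>b\<in>?B. \<Sum>a\<in>?B. \<Sum>c\<in>?B. grade a * ?p b a c)"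
      by (rule sum.swap)
    finally show ?thesis .
  qed
  have "(\<Sum>a\<in>?B. \<Sum>b\<in>?B. \<Sum>c\<in>?B. defect a b c) =
      (\<Sum>a\<in>?B. \<Sum>b\<in>?B. \<Sum>c\<in>?B. grade c * ?p a b c) - (\<Sum>a\<in>?B. \<Sum>b\<in>?B. \<Sum>c\<in>?B. grade a * ?p a b c)
      - (\<Sum>a\<in>?B. \<Sum>b\<in>?B. \<Sum>c\<in>?B. grade b * ?p a b c)"
    unfolding left_diff_distrib sum_subtractf ..
  then have Q: "(\<Sum>a\<in>?B. \<Sum>b\<in>?B. \<Sum>c\<in>?B. defect a b c) / 4 =
      (\<Sum>a\<in>?B. \<Sum>b\<in>?B. \<Sum>c\<in>?B. grade c * ?p a b c) / 4 - (\<Sum>a\<in>?B. \<Sum>b\<in>?B. \<Sum>c\<in>?B. grade a * ?p a b c) / 2"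
    unfolding S2[symmetric] by (simp add: field_simps)
  have "(\<Sum>a\<in>?B. grade a * ricci_form br a a) =
      (\<Sum>a\<in>?B. \<Sum>b\<in>?B. \<Sum>c\<in>?B. grade a * ?p b c a) / 4 - (\<Sum>a\<in>?B. \<Sum>b\<in>?B. \<Sum>c\<in>?B. grade a * ?p a b c) / 2
      - (\<Sum>a\<in>?B. grade a * (br mcv a \<bullet> a))"
    unfolding ric sum_subtractf sum_divide_distrib ..
  then show ?thesis
    unfolding S1 sum_grade_mcv Q .
qed

text \<open>Under these hypotheses \<open>ric(x, x)\<close> is minus the squared norm of the symmetric part of \<open>ad x\<close>; the bound keeps only its
  diagonal entries.\<close>

lemma ricci_form_le:
  assumes orth: "\<And>y z. x \<bullet> br y z = 0" and mcv: "br mcv x \<bullet> x = 0"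
  shows "ricci_form br x x \<le> - (\<Sum>b\<in>adapted_basis. (br x b \<bullet> b)\<^sup>2)"
proof -
  let ?B = adapted_basis
  let ?p = "\<lambda>b c. br x b \<bullet> c"
  have fin: "finite ?B" by (rule orthonormal_basis_finite[OF orthonormal_adapted_basis])
  have eq: "ricci_form br x x = - (\<Sum>b\<in>?B. \<Sum>c\<in>?B. (?p b c)\<^sup>2) / 2 - (\<Sum>b\<in>?B. \<Sum>c\<in>?B. ?p b c * ?p c b) / 2"
    unfolding ricci_form_diagonal[OF bil alt orthonormal_adapted_basis]
    by (simp add: mcv orth inner_commute[of _ x])
  have sym: "(\<Sum>b\<in>?B. \<Sum>c\<in>?B. (?p b c + ?p c b)\<^sup>2) =
      2 * (\<Sum>b\<in>?B. \<Sum>c\<in>?B. (?p b c)\<^sup>2) + 2 * (\<Sum>b\<in>?B. \<Sum>c\<in>?B. ?p b c * ?p c b)"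
  proof -
    have swap: "(\<Sum>b\<in>?B. \<Sum>c\<in>?B. (?p c b)\<^sup>2) = (\<Sum>b\<in>?B. \<Sum>c\<in>?B. (?p b c)\<^sup>2)"
      by (rule sum.swap)
    have "(\<Sum>b\<in>?B. \<Sum>c\<in>?B. (?p b c + ?p c b)\<^sup>2) =
        (\<Sum>b\<in>?B. \<Sum>c\<in>?B. (?p b c)\<^sup>2) + (\<Sum>b\<in>?B. \<Sum>c\<in>?B. (?p c b)\<^sup>2)
        + (\<Sum>b\<in>?B. \<Sum>c\<in>?B. 2 * ?p b c * ?p c b)"
      unfolding power2_sum sum.distrib ..
    also have "(\<Sum>b\<in>?B. \<Sum>c\<in>?B. 2 * ?p b c * ?p c b) = 2 * (\<Sum>b\<in>?B. \<Sum>c\<in>?B. ?p b c * ?p c b)"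
      by (simp only: sum_distrib_left mult.assoc)
    finally show ?thesis using swap by simp
  qed
  have "4 * (\<Sum>b\<in>?B. (?p b b)\<^sup>2) = (\<Sum>b\<in>?B. (?p b b + ?p b b)\<^sup>2)"
    by (simp add: sum_distrib_left power2_eq_square algebra_simps)
  also have "\<dots> \<le> (\<Sum>b\<in>?B. \<Sum>c\<in>?B. (?p b c + ?p c b)\<^sup>2)"
  proof (rule sum_mono)
    fix b assume "b \<in> ?B"
    then show "(?p b b + ?p b b)\<^sup>2 \<le> (\<Sum>c\<in>?B. (?p b c + ?p c b)\<^sup>2)"
      by (intro member_le_sum[of b ?B "\<lambda>c. (?p b c + ?p c b)\<^sup>2"]) (auto simp: fin)
  qed
  finally show ?thesis unfolding eq using sym by linarith
qed

text \<open>The Cauchy-Schwarz inequality for the pairing of the weights with the vector which is 2 on the centre and 1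
  elsewhere, whose squared norm is 18. The relations between the weights make the centre contribute
  exactly half of the trace \<open>h\<close>, so that the pairing equals \<open>3 h / 2\<close>.\<close>

lemma weights_square_sum:
  "(\<Sum>k<9. weights x (flag_index k))\<^sup>2 \<le> 8 * (\<Sum>k<9. (weights x (flag_index k))\<^sup>2)"
proof -
  define d where "d k = weights x (flag_index k)" for k
  define h where "h = (\<Sum>k<9. d k)"
  have rel: "d 0 = d 7 + d 8" "d 0 = d 3 + d 6" "d 0 = d 4 + d 5" "d 1 = d 7 + d 6" "d 1 = d 8 + d 5"
    "d 2 = d 7 + d 4" "d 2 = d 8 + d 3"
    using weights_eq[of x] by (simp_all add: d_def flag_index_simps)
  have center: "2 * (d 0 + d 1 + d 2) = h"
    unfolding h_def sum_9_lessThan using rel by algebra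
  have V: "2 * (d 3 + d 4 + d 5 + d 6 + d 7 + d 8) = h"
    unfolding h_def sum_9_lessThan using rel by algebra
  have "0 \<le> (d 0 - h / 6)\<^sup>2 + (d 1 - h / 6)\<^sup>2 + (d 2 - h / 6)\<^sup>2 + (d 3 - h / 12)\<^sup>2 + (d 4 - h / 12)\<^sup>2
      + (d 5 - h / 12)\<^sup>2 + (d 6 - h / 12)\<^sup>2 + (d 7 - h / 12)\<^sup>2 + (d 8 - h / 12)\<^sup>2"
    by (intro add_nonneg_nonneg zero_le_power2)
  also have "\<dots> = (\<Sum>k<9. (d k)\<^sup>2) - h / 3 * (d 0 + d 1 + d 2)
      - h / 6 * (d 3 + d 4 + d 5 + d 6 + d 7 + d 8) + h\<^sup>2 / 8"
    unfolding sum_9_lessThan by (simp add: power2_eq_square field_simps)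
  also have "\<dots> = (\<Sum>k<9. (d k)\<^sup>2) - h\<^sup>2 / 8"
  proof -
    have halves: "d 0 + d 1 + d 2 = h / 2" "d 3 + d 4 + d 5 + d 6 + d 7 + d 8 = h / 2"
      using center V by simp_all
    show ?thesis unfolding halves by (simp add: power2_eq_square)
  qed
  finally show ?thesis unfolding d_def[symmetric] h_def[symmetric] by simp
qed

text \<open>Pairing with \<open>F\<close> gives \<open>8 e + |H|\<^sup>2 = Q / 4 \<ge> 0\<close>. The reverse inequality comes from evaluating
  the Einstein equation on \<open>H\<close>, or, if \<open>H = 0\<close>, on any vector orthogonal to the derived algebra, which shows
  \<open>e \<le> 0\<close>.\<close>

lemma einstein_defect_zero:
  assumes "einstein_metric br"
  shows "(\<Sum>a\<in>adapted_basis. \<Sum>b\<in>adapted_basis. \<Sum>c\<in>adapted_basis. defect a b c) = 0"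
proof -
  obtain e where e: "\<And>x y. ricci_form br x y = e * (x \<bullet> y)"
    using assms unfolding einstein_metric_def by blast
  define Q where "Q = (\<Sum>a\<in>adapted_basis. \<Sum>b\<in>adapted_basis. \<Sum>c\<in>adapted_basis. defect a b c)"
  define h where "h = mcv \<bullet> mcv"
  have Q: "0 \<le> Q"
    unfolding Q_def by (intro sum_nonneg defect_nonneg)
  have "(\<Sum>a\<in>adapted_basis. grade a * ricci_form br a a) = 8 * e"
    unfolding e sum_grade using frame_inner by simp
  then have 8: "8 * e = Q / 4 - h"
    using sum_grade_ricci by (simp add: Q_def h_def)
  have "8 * e + h \<le> 0"
  proof (cases "h = 0")
    case True
    then have mcv: "mcv = 0" by (simp add: h_def)
    have "span (lie_product br UNIV UNIV) = lie_product br UNIV UNIV"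
      unfolding lie_product_def by (rule span_span)
    then have "span (lie_product br UNIV UNIV) \<subset> span UNIV"
      using solvable_derived_proper[OF solvable] by (metis psubsetI span_UNIV subset_UNIV)
    then obtain x where x: "x \<noteq> 0" "\<And>y. y \<in> span (lie_product br UNIV UNIV) \<Longrightarrow> orthogonal x y"
      using orthogonal_to_subspace_exists_gen by blast
    have "x \<bullet> br y z = 0" for y z
      using x(2)[OF span_base[OF lie_product_base[of y UNIV z UNIV br]]] by (simp add: orthogonal_def)
    then have "ricci_form br x x \<le> - (\<Sum>b\<in>adapted_basis. (br x b \<bullet> b)\<^sup>2)"
      by (rule ricci_form_le) (simp add: mcv bilinear_lzero[OF bil])
    also have "\<dots> \<le> 0" by (simp add: sum_nonneg)
    finally have "e * (x \<bullet> x) \<le> 0" unfolding e .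
    moreover have "0 < x \<bullet> x" using x(1) by simp
    ultimately have "e \<le> 0" by (simp add: mult_le_0_iff)
    then show ?thesis using True by simp
  next
    case False
    then have h: "0 < h" by (simp add: h_def)
    have "e * h \<le> - (\<Sum>b\<in>adapted_basis. (br mcv b \<bullet> b)\<^sup>2)"
      unfolding h_def e[symmetric] by (rule ricci_form_le) (simp_all add: mcv_orthogonal alt)
    also have "\<dots> \<le> - (\<Sum>k<9. (weights mcv (flag_index k))\<^sup>2)"
      unfolding sum_adapted_basis by (simp add: frame_diagonal sum_nonneg)
    also have "\<dots> \<le> - (h\<^sup>2 / 8)"
      using weights_square_sum[of mcv] unfolding mcv_norm[symmetric] h_def[symmetric] by simp
    finally have "(8 * e + h) * h \<le> 0"
      by (simp add: power2_eq_square algebra_simps)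
    then show ?thesis using h by (simp add: mult_le_0_iff)
  qed
  then have "Q = 0" using Q 8 by simp
  then show ?thesis by (simp add: Q_def)
qed

text \<open>If \<open>Q = 0\<close>, the bracket is graded in the adapted basis. The last two frame vectors have degree 0 and so
  provide, after normalisation, a complement of the kind excluded by \<open>no_graded_complement\<close>; the
  functional is the inner product with \<open>frame 0\<close>, which spans \<open>L\<close>.\<close>

lemma defect_zero_False:
  assumes zero: "(\<Sum>a\<in>adapted_basis. \<Sum>b\<in>adapted_basis. \<Sum>c\<in>adapted_basis. defect a b c) = 0"
  shows False
proof -
  let ?B = adapted_basis
  have fin: "finite ?B" by (rule orthonormal_basis_finite[OF orthonormal_adapted_basis])
  have graded: "grade c = grade a + grade b \<or> br a b \<bullet> c = 0"
    if "a \<in> ?B" "b \<in> ?B" "c \<in> ?B" for a b c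
  proof -
    have "(\<Sum>b\<in>?B. \<Sum>c\<in>?B. defect a b c) = 0"
      by (rule sum_nonneg_0[OF fin _ zero that(1)]) (intro sum_nonneg defect_nonneg)
    from sum_nonneg_0[OF fin _ this that(2)] have "(\<Sum>c\<in>?B. defect a b c) = 0"
      using that(1) by (simp add: sum_nonneg defect_nonneg)
    from sum_nonneg_0[OF fin _ this that(3)] have "defect a b c = 0"
      using that(1,2) by (simp add: defect_nonneg)
    then show ?thesis by auto
  qed
  have B: "frame k \<in> ?B" if "k < 9" for k using that by (simp add: adapted_basis_def)
  have top: "grade (frame k) = 0" "frame k \<in> range \<phi>" if "k = 7 \<or> k = 8" for k
    using that flag_range[OF frame(1)[of k]] by (auto simp: grade_def frame_in_flag_iff)
  have commute: "br (frame 7) (frame 8) = 0"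
  proof -
    have "br (frame 7) (frame 8) \<bullet> c = 0" if c: "c \<in> ?B" for c
    proof (cases "c \<in> flag 7")
      case True
      then have "grade c \<noteq> 0" by (simp add: grade_def)
      then show ?thesis using graded[OF B B c, of 7 8] top(1)[of 7] top(1)[of 8] by simp
    next
      case False
      have "br (frame 7) (frame 8) \<in> flag 7"
        using br_range_flag_3[OF top(2) top(2), of 7 8] flag_mono[of 3 7] by auto
      then show ?thesis using adapted_basis_flag[OF c _ False] by simp
    qed
    then show ?thesis
      using orthonormal_basis_expand[OF orthonormal_adapted_basis, of "br (frame 7) (frame 8)"] by simp
  qed
  have orth: "br (frame k) w \<bullet> frame 0 = 0" if k: "k = 7 \<or> k = 8" and w: "w \<in> flag 7" for k w
  proof -
    have l: "linear (br (frame k))" using bil by (simp add: bilinear_def)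
    have "br (frame k) w = br (frame k) (\<Sum>b\<in>?B. (w \<bullet> b) *\<^sub>R b)"
      using orthonormal_basis_expand[OF orthonormal_adapted_basis, of w] by simp
    also have "\<dots> = (\<Sum>b\<in>?B. (w \<bullet> b) *\<^sub>R br (frame k) b)"
      by (simp add: linear_sum[OF l] linear_cmul[OF l])
    finally have "br (frame k) w \<bullet> frame 0 = (\<Sum>b\<in>?B. (w \<bullet> b) * (br (frame k) b \<bullet> frame 0))"
      by (simp add: inner_sum_left)
    also have "\<dots> = 0"
    proof (rule sum.neutral, rule ballI)
      fix b assume b: "b \<in> ?B"
      consider "b \<notin> flag 7" | "b \<in> flag 1" | "b \<in> flag 7" "b \<notin> flag 1" by blast
      then show "(w \<bullet> b) * (br (frame k) b \<bullet> frame 0) = 0"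
      proof cases
        case 1
        then show ?thesis using adapted_basis_flag[OF b _ 1 w] by simp
      next
        case 2
        then have "b \<in> flag 3" using flag_mono[of 1 3] by auto
        then show ?thesis using br_center[OF top(2)[OF k]] by simp
      next
        case 3
        then have "grade b = 1" by (simp add: grade_def)
        moreover have "grade (frame 0) = 2" by (simp add: grade_def frame_in_flag_iff)
        moreover have "k < 9" using k by auto
        ultimately show ?thesis using graded[OF B b B, of k 0] top(1)[OF k] by simp
      qed
    qed
    finally show ?thesis .
  qed
  obtain v7 where v7: "frame 7 = \<phi> v7" using top(2)[of 7] by auto
  obtain v8 where v8: "frame 8 = \<phi> v8" using top(2)[of 8] by auto
  obtain v0 where v0: "frame 0 = \<phi> v0" using flag_range[OF frame(1)[of 0]] by auto
  have v72: "v7 $ 2 = 0"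
    using frame(1)[of 7] by (simp add: v7 in_flag less_9_cases flag_index_simps)
  have v71: "v7 $ 1 \<noteq> 0"
    using frame_in_flag_iff[of 7 7] v72 by (simp add: v7 in_flag_7)
  have v82: "v8 $ 2 \<noteq> 0"
    using frame_in_flag_iff[of 8 8] by (simp add: v8 in_flag less_9_cases flag_index_simps)
  define y1 where "y1 = (1 / v7 $ 1) *\<^sub>R v7"
  define y2 where "y2 = (1 / v8 $ 2) *\<^sub>R (v8 - v8 $ 1 *\<^sub>R y1)"
  define \<xi> where "\<xi> v = \<phi> v \<bullet> frame 0" for v
  have lin_\<xi>: "linear \<xi>"
    unfolding \<xi>_def by (rule linearI) (simp_all add: linear_add[OF lin] linear_cmul[OF lin] inner_add_left)
  note bm = bilinear_mu[of t]
  have "\<phi> (mu t v7 v8) = 0" using commute by (simp add: hom v7 v8)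
  then have "mu t v7 v8 = 0" using inj linear_0[OF lin] by (metis injD)
  then have y12: "mu t y1 y2 = 0"
    unfolding y1_def y2_def
    by (simp add: bilinear_lmul[OF bm] bilinear_rmul[OF bm] bilinear_rsub[OF bm])
       (simp add: mu_def minor2_def)
  have mem: "\<phi> (bv i) \<in> flag 7" if "i \<in> {3, 4, 5, 6}" for i
    using that by (auto simp: in_flag_7 bv_nth)
  have o7: "\<xi> (mu t v7 (bv i)) = 0" and o8: "\<xi> (mu t v8 (bv i)) = 0" if "i \<in> {3, 4, 5, 6}" for i
    using orth[OF _ mem[OF that], of 7] orth[OF _ mem[OF that], of 8] by (simp_all add: \<xi>_def hom v7 v8)
  have o1: "\<xi> (mu t y1 (bv i)) = 0" if "i \<in> {3, 4, 5, 6}" for i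
    using o7[OF that] by (simp add: y1_def bilinear_lmul[OF bm] linear_cmul[OF lin_\<xi>])
  have o2: "\<xi> (mu t y2 (bv i)) = 0" if "i \<in> {3, 4, 5, 6}" for i
    using o8[OF that] o1[OF that]
    by (simp add: y2_def bilinear_lmul[OF bm] bilinear_lsub[OF bm] linear_cmul[OF lin_\<xi>] linear_diff[OF lin_\<xi>])
  have xi7: "\<xi> (bv 7) \<noteq> 0"
  proof -
    have "\<forall>j\<in>{1, 2, 3, 4, 5, 6, 8, 9}. v0 $ j = 0"
      using frame(1)[of 0] unfolding in_flag_1[symmetric] v0 by simp
    then have "v0 = v0 $ 7 *\<^sub>R bv 7" unfolding vec_eq_iff all_9 by (simp add: bv_nth)
    then have "frame 0 = v0 $ 7 *\<^sub>R \<phi> (bv 7)" using v0 linear_cmul[OF lin] by metis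
    then have "frame 0 \<bullet> frame 0 = v0 $ 7 * \<xi> (bv 7)" unfolding \<xi>_def by (metis inner_scaleR_left)
    then show ?thesis using frame_inner[of 0 0] by auto
  qed
  show False
  proof (rule no_graded_complement[of t y1 y2 \<xi>])
    show "y1 $ 1 = 1" "y1 $ 2 = 0" "y2 $ 1 = 0" "y2 $ 2 = 1"
      using v71 v72 v82 by (simp_all add: y1_def y2_def)
  qed (use t y12 lin_\<xi> xi7 o1 o2 in simp_all)
qed

end

lemma mu_not_einstein_nilradical:
  assumes "1 < t"
  shows "\<not> einstein_nilradical TYPE('s::euclidean_space) (mu t)"
proof
  assume "einstein_nilradical TYPE('s) (mu t)"
  then obtain br :: "'s \<Rightarrow> 's \<Rightarrow> 's" and \<phi> where br: "standard_einstein_solvmanifold br"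
    "linear \<phi>" "inj \<phi>" "\<And>x y. \<phi> (mu t x y) = br (\<phi> x) (\<phi> y)" "is_nilradical br (range \<phi>)"
    unfolding einstein_nilradical_def by blast
  interpret nilradical_mu t br \<phi>
    using assms br unfolding standard_einstein_solvmanifold_def nilradical_mu_def by blast
  show False
    using br(1) einstein_defect_zero defect_zero_False
    unfolding standard_einstein_solvmanifold_def by blast
qed

theorem theorem4p3:
  shows "(\<forall>t s :: real. 1 < t \<and> 1 < s \<and> t \<noteq> s \<longrightarrow> \<not> lie_isomorphic (mu t) (mu s)) \<and>
    (\<forall>t :: real. 1 < t \<longrightarrow> \<not> einstein_nilradical TYPE('s::euclidean_space) (mu t))"
  using mu_isomorphic_imp_eq mu_not_einstein_nilradical by blast

end
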